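(* Let $d\ge 1$ be an integer, $T>0$, and let $\mu$ be a Borel probability measure on $\mathbb{R}^d$ with density $\rho\ge 0$ (with respect to Lebesgue measure; $\rho$ is not required to be positive everywhere). Put $\varphi(y)=\rho(y)/G_T(y)$, where $G_T(y)=(2\pi T)^{-d/2}e^{-|y|^2/(2T)}$ for $y\in\mathbb{R}^d$. Assume: (i) with the convention $0\cdot\log 0=0$, $\int_{\mathbb{R}^d}\rho(y)\left(|y|^2+\log\rho(y)\right)dy<\infty$; (ii) there exists a positive constant $C_1$ such that $$|\varphi(x)-\varphi(y)|\le C_1\left(1+\varphi(x)+\varphi(y)\right)|x-y|,\quad x,y\in\mathbb{R}^d.$$ For $\varepsilon\in(0,1)$ and $n\in\mathbb{N}$ let $\{Y_i^{\varepsilon}\}_{i=0}^n$ be defined by $$Y_0^{\varepsilon}=0,\qquad Y_{i+1}^{\varepsilon}=Y_i^{\varepsilon}+b_{\varepsilon}(t_i,Y_i^{\varepsilon})\frac{T}{n}+\sqrt{\frac{T}{n}}\,Z_{i+1},\quad i=0,1,\ldots,n-1,$$ where $t_i=iT/n$, $Z_1,\ldots,Z_n$ are i.i.d. $d$-dimensional standard normal random vectors on $(\Omega,\mathcal{F},\mathbb{P})$, and $$b_{\varepsilon}(t,y)=\frac{(1-\varepsilon)\nabla\mathbb{E}[\varphi(y+\sqrt{T-t}\,Z)]}{(1-\varepsilon)\mathbb{E}[\varphi(y+\sqrt{T-t}\,Z)]+\varepsilon},\quad (t,y)\in[0,T)\times\mathbb{R}^d,$$ with $Z$ a $d$-dimensional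 standard normal random vector and $\nabla$ the gradient in $y$. Denote by $\mathcal{L}(Y_n^{\varepsilon})$ the distribution of $Y_n^{\varepsilon}$ under $\mathbb{P}$. Then $$\lim_{\varepsilon\to 0}\lim_{n\to\infty}\delta(\mathcal{L}(Y_n^{\varepsilon}),\mu)=0,$$ where $\delta$ is the total variation distance.
   Context: $(\Omega,\mathcal{F},\mathbb{P})$ is an atomless and complete probability space, and $\mathbb{E}$ denotes expectation with respect to $\mathbb{P}$. $|\cdot|$ is the Euclidean norm on $\mathbb{R}^d$. The total variation distance between Borel probability measures $\nu_1,\nu_2$ on $\mathbb{R}^d$ is $$\delta(\nu_1,\nu_2)=\sup_{A\in\mathcal{B}(\mathbb{R}^d)}|\nu_1(A)-\nu_2(A)|,$$ where $\mathcal{B}(\mathbb{R}^d)$ is the Borel $\sigma$-algebra. The drift satisfies $b_{\varepsilon}(t,y)=\nabla\log\mathbb{E}[\varphi_{\varepsilon}(y+\sqrt{T-t}\,Z)]$ with $\varphi_{\varepsilon}=(1-\varepsilon)\varphi+\varepsilon=\rho_{\varepsilon}/G_T$, where $\rho_{\varepsilon}=(1-\varepsilon)\rho+\varepsilon G_T$ is a positive probability density. The scheme is the Euler-Maruyama discretization, with step $T/n$, of $dX_t=b_{\varepsilon}(t,X_t)\,dt+dB_t$, $X_0=0$, where $B$ is a $d$-dimensional standard Brownian motion. *)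

theory Defs
  imports "HOL-Probability.Probability"
begin

definition atomless :: "'w measure \<Rightarrow> bool" where
  "atomless M \<longleftrightarrow>
     (\<forall>A\<in>sets M. 0 < emeasure M A \<longrightarrow>
        (\<exists>B\<in>sets M. B \<subseteq> A \<and> 0 < emeasure M B \<and> emeasure M B < emeasure M A))"

definition tv_dist :: "'a::topological_space measure \<Rightarrow> 'a measure \<Rightarrow> real" where
  "tv_dist \<nu>1 \<nu>2 = (SUP A\<in>sets borel. \<bar>measure \<nu>1 A - measure \<nu>2 A\<bar>)"

text \<open>The density of the centred Gaussian law with covariance \<open>s\<close> times the identity;
  \<open>s\<close> is the variance, unlike in the library's \<^const>\<open>normal_density\<close>, whose parameter is the
  standard deviation.\<close>

definition gauss_density :: "real \<Rightarrow> 'a::euclidean_space \<Rightarrow> real" where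
  "gauss_density s y = (2 * pi * s) powr (- real DIM('a) / 2) * exp (- (norm y)\<^sup>2 / (2 * s))"

definition std_normal_vector :: "'w measure \<Rightarrow> ('w \<Rightarrow> 'a::euclidean_space) \<Rightarrow> bool" where
  "std_normal_vector M Z \<longleftrightarrow> distributed M lborel Z (\<lambda>x. ennreal (gauss_density 1 x))"

text \<open>Meaningful only where \<open>f\<close> is differentiable, as \<^const>\<open>deriv\<close> is.\<close>

definition grad :: "('a::real_inner \<Rightarrow> real) \<Rightarrow> 'a \<Rightarrow> 'a" where
  "grad f y = (THE D. GDERIV f y :> D)"

definition drift ::
  "'w measure \<Rightarrow> ('w \<Rightarrow> 'a::euclidean_space) \<Rightarrow> real \<Rightarrow> ('a \<Rightarrow> real) \<Rightarrow> real \<Rightarrow> real \<Rightarrow> 'a \<Rightarrow> 'a" where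
  "drift M Z T \<phi> \<epsilon> t y =
     (let u = (\<lambda>x. \<integral>w. \<phi> (x + sqrt (T - t) *\<^sub>R Z w) \<partial>M)
      in ((1 - \<epsilon>) *\<^sub>R grad u y) /\<^sub>R ((1 - \<epsilon>) * u y + \<epsilon>))"

text \<open>Only the noise variables \<open>Z 1, \<dots>, Z n\<close> enter the first \<open>n\<close> steps; \<open>Z 0\<close> is unused.\<close>

primrec euler_maruyama ::
  "(real \<Rightarrow> 'a::real_normed_vector \<Rightarrow> 'a) \<Rightarrow> real \<Rightarrow> nat \<Rightarrow> (nat \<Rightarrow> 'w \<Rightarrow> 'a) \<Rightarrow> nat \<Rightarrow> 'w \<Rightarrow> 'a" where
  "euler_maruyama b T n Z 0 w = 0"
| "euler_maruyama b T n Z (Suc i) w =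
     euler_maruyama b T n Z i w
     + (T / real n) *\<^sub>R b (real i * T / real n) (euler_maruyama b T n Z i w)
     + sqrt (T / real n) *\<^sub>R Z (Suc i) w"

end

theory Submission
  imports Defs
begin

text \<open>
  The proof compares two Markov chains on the grid \<open>t\<^sub>i = i h\<close>, \<open>h = T/n\<close>. Write \<open>F\<close> for the mixture
  \<open>(1 - \<epsilon>) \<phi> + \<epsilon>\<close> and \<open>u\<^sub>i = heat (T - t\<^sub>i) F\<close> for its Gaussian averages, so that the drift of the scheme
  is \<open>\<nabla> log u\<^sub>i\<close>. The first chain is the Doob transform of a Gaussian random walk by the space-time
  harmonic function \<open>u\<close>: its transition density is the Gaussian one times \<open>u\<^sub>i\<^sub>+\<^sub>1(y)/u\<^sub>i(x)\<close>, and, the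
  factors telescoping, its law at time \<open>T\<close> is exactly the mixture \<open>\<nu> = (1 - \<epsilon>) \<mu> + \<epsilon> N(0, T I)\<close>.
  The second chain is the Euler scheme. Since \<open>\<nu>\<close> is within \<open>\<epsilon>\<close> of \<open>\<mu>\<close> in total variation, it suffices
  that the law of the Euler scheme tends to \<open>\<nu>\<close> for each fixed \<open>\<epsilon>\<close>. What has
  to be compared are thus the one-step kernels of the two chains.

  Let \<open>P\<^sub>i\<close> and \<open>Q\<^sub>i\<close> be these kernels and suppose \<open>\<integral> (dP\<^sub>i/dQ\<^sub>i)\<^sup>2 dQ\<^sub>i \<le> 1 + c\<^sub>i\<close> uniformly in the starting
  point. By Cauchy-Schwarz \<open>(P\<^sub>i g)\<^sup>2 \<le> (1 + c\<^sub>i) Q\<^sub>i(g\<^sup>2)\<close>, and chaining this backwards from time \<open>T\<close> gives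
  \<open>(\<integral> f d\<nu>)\<^sup>2 \<le> \<Prod> (1 + c\<^sub>i) \<cdot> E f(Y\<^sub>n)\<^sup>2\<close> for every \<open>f \<ge> 0\<close> (\<open>doob_euler_maruyama\<close>). Testing with
  \<open>f = 1 + t (1\<^sub>A - P(Y\<^sub>n \<in> A))\<close> and optimizing over \<open>t\<close> bounds the total variation distance by the
  square root of \<open>\<Prod> (1 + c\<^sub>i) - 1\<close> (\<open>tv_dist_euler_maruyama_le\<close>).

  The analytic input is \<open>c\<^sub>i = O(h\<^sup>2 / max s h)\<close>, where \<open>s = T - t\<^sub>i\<^sub>+\<^sub>1\<close> is the time that remains after the
  step (\<open>chi_square_one_step\<close>). It rests on the growth condition, which after mixing in \<open>\<epsilon>\<close> says that
  \<open>log F\<close> is Lipschitz (\<open>log_lipschitz_mixture\<close>). The heat semigroup preserves this; relative to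
  \<open>heat s F\<close> itself, it makes the gradient bounded and the second-order remainder in an increment \<open>a\<close>
  of order \<open>|a|\<^sup>2/\<surd>s\<close> (\<open>heat_first_order\<close>, \<open>heat_time_increment\<close>). Summing over the steps gives
  \<open>\<Sum> c\<^sub>i = O(ln n / n)\<close>, which tends to 0.
\<close>

section \<open>Gaussian calculus\<close>

definition std_gauss :: "'a::euclidean_space measure" where
  "std_gauss = density lborel (\<lambda>x. ennreal (gauss_density 1 x))"

lemma gauss_density_measurable [measurable]: "gauss_density s \<in> borel_measurable borel"
  unfolding gauss_density_def by measurable

lemma gauss_density_pos: "s > 0 \<Longrightarrow> gauss_density s y > 0"
  unfolding gauss_density_def by simp

lemma gauss_density_nonneg [simp]: "gauss_density s y \<ge> 0"
  unfolding gauss_density_def by simp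

lemma sets_std_gauss [simp, measurable_cong]: "sets std_gauss = sets borel"
  unfolding std_gauss_def by simp

lemma space_std_gauss [simp]: "space std_gauss = UNIV"
  unfolding std_gauss_def by simp

lemma prob_space_std_gauss: "prob_space (std_gauss :: 'a::euclidean_space measure)"
proof
  have 1: "gauss_density 1 x = (\<Prod>b\<in>Basis. std_normal_density (x \<bullet> b))" for x :: 'a
  proof -
    have "(\<Prod>b\<in>Basis. std_normal_density (x \<bullet> b))
        = (\<Prod>b\<in>(Basis::'a set). (2 * pi) powr (-1/2)) * (\<Prod>b\<in>Basis. exp (- (x \<bullet> b)\<^sup>2 / 2))"
      unfolding prod.distrib[symmetric]
      by (intro prod.cong refl) (simp add: std_normal_density_def powr_minus_divide powr_half_sqrt)
    also have "(\<Prod>b\<in>(Basis::'a set). (2 * pi) powr (-1/2)) = (2 * pi) powr (- real DIM('a) / 2)"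
      by (simp add: powr_realpow[symmetric] powr_powr)
    also have "(\<Prod>b\<in>Basis. exp (- (x \<bullet> b)\<^sup>2 / 2)) = exp (- (norm x)\<^sup>2 / 2)"
      by (simp add: exp_sum[symmetric] sum_negf sum_divide_distrib[symmetric]
          power2_norm_eq_inner power2_eq_square[of "x \<bullet> _"] euclidean_inner[of x x])
    finally show ?thesis unfolding gauss_density_def by simp
  qed
  have "(\<integral>\<^sup>+x. ennreal (std_normal_density x) \<partial>lborel) = 1"
    using prob_space.emeasure_space_1[OF prob_space_normal_density[of 1 0]]
    by (simp add: emeasure_density)
  hence "(\<integral>\<^sup>+x. ennreal (gauss_density 1 (x::'a)) \<partial>lborel) = 1"
    unfolding 1 by (simp add: prod_ennreal[symmetric] nn_integral_lborel_prod[of "\<lambda>_ x. ennreal (std_normal_density x)"])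
  thus "emeasure (std_gauss :: 'a measure) (space std_gauss) = 1"
    unfolding std_gauss_def by (simp add: emeasure_density)
qed

interpretation std_gauss: prob_space "std_gauss :: 'a::euclidean_space measure"
  by (rule prob_space_std_gauss)

lemma emeasure_std_gauss_UNIV [simp]: "emeasure (std_gauss :: 'a::euclidean_space measure) UNIV = 1"
  using prob_space.emeasure_space_1[OF prob_space_std_gauss] by simp

lemma nn_integral_std_gauss:
  assumes [measurable]: "f \<in> borel_measurable borel"
  shows "(\<integral>\<^sup>+z. f z \<partial>std_gauss) = (\<integral>\<^sup>+z. f z * ennreal (gauss_density 1 z) \<partial>lborel)"
  unfolding std_gauss_def by (subst nn_integral_density) (auto simp: mult.commute)

lemma nn_integral_lborel_affine:
  fixes t :: "'a::euclidean_space"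
  assumes [measurable]: "f \<in> borel_measurable borel" and c: "c \<noteq> 0"
  shows "(\<integral>\<^sup>+y. f y \<partial>lborel) = (\<integral>\<^sup>+x. f (t + c *\<^sub>R x) * ennreal (\<bar>c\<bar> ^ DIM('a)) \<partial>lborel)"
  by (subst lborel_affine[OF c, of t])
     (simp add: nn_integral_density nn_integral_distr mult.commute)

lemma nn_integral_std_gauss_scaled:
  fixes f :: "'a::euclidean_space \<Rightarrow> ennreal"
  assumes [measurable]: "f \<in> borel_measurable borel" and s: "s > 0"
  shows "(\<integral>\<^sup>+z. f (sqrt s *\<^sub>R z) \<partial>std_gauss) = (\<integral>\<^sup>+y. f y * ennreal (gauss_density s y) \<partial>lborel)"
proof -
  have *: "gauss_density s (sqrt s *\<^sub>R x) * sqrt s ^ DIM('a) = gauss_density 1 x" for x :: 'a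
  proof -
    have "sqrt s ^ DIM('a) = s powr (real DIM('a) / 2)"
      using s by (simp add: powr_half_sqrt[symmetric] powr_realpow[symmetric] powr_powr)
    moreover have "(2 * pi * s) powr (- real DIM('a) / 2)
        = (2 * pi) powr (- real DIM('a) / 2) * s powr (- real DIM('a) / 2)"
      using s by (simp add: powr_mult)
    moreover have "s powr (- real DIM('a) / 2) * s powr (real DIM('a) / 2) = 1"
      using s by (simp add: powr_add[symmetric])
    ultimately show ?thesis using s
      by (simp add: gauss_density_def power_mult_distrib mult_ac)
  qed
  have "(\<integral>\<^sup>+y. f y * ennreal (gauss_density s y) \<partial>lborel)
      = (\<integral>\<^sup>+x. f (sqrt s *\<^sub>R x) * ennreal (gauss_density s (sqrt s *\<^sub>R x))
             * ennreal (\<bar>sqrt s\<bar> ^ DIM('a)) \<partial>lborel)"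
    using s by (subst nn_integral_lborel_affine[of _ "sqrt s" 0]) auto
  also have "\<dots> = (\<integral>\<^sup>+x. f (sqrt s *\<^sub>R x) * ennreal (gauss_density 1 x) \<partial>lborel)"
    using s by (intro nn_integral_cong)
       (simp add: mult.assoc ennreal_mult[symmetric] * del: ennreal_power)
  finally show ?thesis by (simp add: nn_integral_std_gauss)
qed

text \<open>Cameron-Martin formula for a constant shift. It is used in two ways: to differentiate a
  Gaussian average without differentiating the integrand, and to exchange the Euler step, whose noise
  has a shifted mean, for a centred one.\<close>
lemma nn_integral_std_gauss_shift:
  fixes f :: "'a::euclidean_space \<Rightarrow> ennreal"
  assumes [measurable]: "f \<in> borel_measurable borel"
  shows "(\<integral>\<^sup>+z. f z \<partial>std_gauss)
       = (\<integral>\<^sup>+z. f (z + a) * ennreal (exp (- (a \<bullet> z) - (norm a)\<^sup>2 / 2)) \<partial>std_gauss)"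
proof -
  have *: "gauss_density 1 (a + x) = exp (- (a \<bullet> x) - (norm a)\<^sup>2 / 2) * gauss_density 1 x" for x
    unfolding gauss_density_def
    by (simp add: exp_add[symmetric] power2_norm_eq_inner inner_add_left inner_add_right
        inner_commute field_simps)
  have "(\<integral>\<^sup>+z. f z \<partial>std_gauss) = (\<integral>\<^sup>+x. f (a + x) * ennreal (gauss_density 1 (a + x)) \<partial>lborel)"
    unfolding nn_integral_std_gauss[OF assms]
    by (subst nn_integral_lborel_affine[of _ 1 a]) auto
  also have "\<dots> = (\<integral>\<^sup>+z. f (z + a) * ennreal (exp (- (a \<bullet> z) - (norm a)\<^sup>2 / 2)) \<partial>std_gauss)"
    unfolding *
    by (subst nn_integral_std_gauss) (auto intro!: nn_integral_cong simp: ennreal_mult mult.assoc add.commute)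
  finally show ?thesis .
qed

lemma nn_integral_std_gauss_uminus:
  fixes f :: "'a::euclidean_space \<Rightarrow> ennreal"
  assumes [measurable]: "f \<in> borel_measurable borel"
  shows "(\<integral>\<^sup>+z. f (- z) \<partial>std_gauss) = (\<integral>\<^sup>+z. f z \<partial>std_gauss)"
proof -
  have "(\<integral>\<^sup>+z. f z \<partial>std_gauss) = (\<integral>\<^sup>+x. f (- x) * ennreal (gauss_density 1 (- x)) \<partial>lborel)"
    unfolding nn_integral_std_gauss[OF assms]
    by (subst nn_integral_lborel_affine[of _ "-1" 0]) auto
  also have "\<dots> = (\<integral>\<^sup>+z. f (- z) \<partial>std_gauss)"
    by (subst nn_integral_std_gauss) (auto simp: gauss_density_def)
  finally show ?thesis by simp
qed

text \<open>Completing the square in \<open>x\<close>: given that \<open>x\<close> and \<open>y - x\<close> are independent Gaussians of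
  variances \<open>h\<close> and \<open>s\<close>, the conditional law of \<open>x\<close> given the sum \<open>y\<close> has mean \<open>m y\<close> and
  variance \<open>v\<close>.\<close>
lemma gauss_density_convolution:
  fixes x y :: "'a::euclidean_space"
  assumes s: "s > 0" and h: "h > 0"
  defines "v \<equiv> s * h / (s + h)" and "m \<equiv> h / (s + h)"
  shows "gauss_density h x * gauss_density s (y - x)
       = gauss_density (s + h) y * gauss_density v (x - m *\<^sub>R y)"
proof -
  have "(2 * pi * h) powr (- real DIM('a) / 2) * (2 * pi * s) powr (- real DIM('a) / 2)
      = (2 * pi * (s + h)) powr (- real DIM('a) / 2) * (2 * pi * v) powr (- real DIM('a) / 2)"
  proof -
    have "2 * pi * h * (2 * pi * s) = 2 * pi * (s + h) * (2 * pi * v)"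
      using s h by (simp add: v_def divide_simps)
    moreover have "v > 0" using s h by (simp add: v_def)
    ultimately show ?thesis using s h by (simp only: powr_mult[symmetric])
  qed
  moreover have "(norm x)\<^sup>2 / (2 * h) + (norm (y - x))\<^sup>2 / (2 * s)
      = (norm y)\<^sup>2 / (2 * (s + h)) + (norm (x - m *\<^sub>R y))\<^sup>2 / (2 * v)"
  proof -
    define X Y P where "X = x \<bullet> x" and "Y = y \<bullet> y" and "P = x \<bullet> y"
    have sh: "s + h \<noteq> 0" using s h by simp
    have 1: "(norm (y - x))\<^sup>2 = Y - 2 * P + X"
      by (simp add: power2_norm_eq_inner inner_diff_left inner_diff_right X_def Y_def P_def inner_commute)
    have 2: "(norm (x - m *\<^sub>R y))\<^sup>2 = X - 2 * m * P + m\<^sup>2 * Y"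
      by (simp add: power2_norm_eq_inner inner_diff_left inner_diff_right X_def Y_def P_def inner_commute
          power2_eq_square[of m])
    have 3: "(norm x)\<^sup>2 = X" "(norm y)\<^sup>2 = Y" by (simp_all add: power2_norm_eq_inner X_def Y_def)
    have "(X - 2 * m * P + m\<^sup>2 * Y) / (2 * v)
       = X * (s + h) / (2 * s * h) - P / s + h * Y / (2 * s * (s + h))"
    proof -
      have "X / (2 * v) = X * (s + h) / (2 * s * h)"
        using s h sh unfolding v_def by (simp add: mult_ac)
      moreover have "2 * m * P / (2 * v) = P / s"
        using s h sh unfolding v_def m_def by simp
      moreover have "m\<^sup>2 * Y / (2 * v) = h * Y / (2 * s * (s + h))"
        using s h sh unfolding v_def m_def by (simp add: power2_eq_square mult_ac)
      ultimately show ?thesis by (simp add: diff_divide_distrib add_divide_distrib)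
    qed
    moreover have "Y / (2 * (s + h)) + h * Y / (2 * s * (s + h)) = Y / (2 * s)"
      using s h sh by (simp add: divide_simps) (simp add: algebra_simps)
    moreover have "X * (s + h) / (2 * s * h) = X / (2 * h) + X / (2 * s)"
      using s h sh by (simp add: field_simps)
    ultimately show ?thesis unfolding 1 2 3 by (simp add: diff_divide_distrib add_divide_distrib)
  qed
  hence "exp (- (norm x)\<^sup>2 / (2 * h)) * exp (- (norm (y - x))\<^sup>2 / (2 * s))
      = exp (- (norm y)\<^sup>2 / (2 * (s + h))) * exp (- (norm (x - m *\<^sub>R y))\<^sup>2 / (2 * v))"
    by (simp add: exp_add[symmetric])
  moreover have "(a * b) * (c * d) = (a' * b') * (c' * d')"
    if "a * c = a' * c'" "b * d = b' * d'" for a b c d a' b' c' d' :: real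
  proof -
    have "(a * b) * (c * d) = (a * c) * (b * d)" by (simp only: mult_ac)
    also have "\<dots> = (a' * c') * (b' * d')" by (simp only: that)
    finally show ?thesis by (simp only: mult_ac)
  qed
  ultimately show ?thesis unfolding gauss_density_def by blast
qed

lemma nn_integral_gauss_density:
  fixes a :: "'a::euclidean_space"
  assumes "s > 0"
  shows "(\<integral>\<^sup>+x. ennreal (gauss_density s (x - a)) \<partial>lborel) = 1"
proof -
  have "(\<integral>\<^sup>+x. ennreal (gauss_density s (x - a)) \<partial>lborel) = (\<integral>\<^sup>+x. ennreal (gauss_density s (x::'a)) \<partial>lborel)"
    by (subst nn_integral_lborel_affine[of _ 1 a]) auto
  also have "\<dots> = (\<integral>\<^sup>+z. 1 \<partial>(std_gauss::'a measure))"
    using nn_integral_std_gauss_scaled[of "\<lambda>_::'a. 1" s] assms by simp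
  finally show ?thesis by simp
qed

lemma nn_integral_std_gauss_semigroup:
  fixes f :: "'a::euclidean_space \<Rightarrow> ennreal"
  assumes [measurable]: "f \<in> borel_measurable borel" and s: "s \<ge> 0" and h: "h \<ge> 0"
  shows "(\<integral>\<^sup>+w. (\<integral>\<^sup>+z. f (x + sqrt h *\<^sub>R w + sqrt s *\<^sub>R z) \<partial>std_gauss) \<partial>std_gauss)
       = (\<integral>\<^sup>+z. f (x + sqrt (s + h) *\<^sub>R z) \<partial>std_gauss)"
proof (cases "s = 0 \<or> h = 0")
  case True
  then show ?thesis by auto
next
  case False
  with s h have s: "s > 0" and h: "h > 0" by auto
  have "(\<integral>\<^sup>+w. (\<integral>\<^sup>+z. f (x + sqrt h *\<^sub>R w + sqrt s *\<^sub>R z) \<partial>std_gauss) \<partial>std_gauss)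
      = (\<integral>\<^sup>+u. (\<integral>\<^sup>+z. f (x + u + sqrt s *\<^sub>R z) \<partial>std_gauss) * ennreal (gauss_density h u) \<partial>lborel)"
    using h by (intro nn_integral_std_gauss_scaled) auto
  also have "\<dots> = (\<integral>\<^sup>+u. (\<integral>\<^sup>+y. f (x + u + y) * ennreal (gauss_density s y) \<partial>lborel) * ennreal (gauss_density h u) \<partial>lborel)"
    using s by (subst nn_integral_std_gauss_scaled) auto
  also have "\<dots> = (\<integral>\<^sup>+u. (\<integral>\<^sup>+y. f (x + y) * ennreal (gauss_density s (y - u)) \<partial>lborel) * ennreal (gauss_density h u) \<partial>lborel)"
  proof (intro nn_integral_cong)
    fix u :: 'a
    show "(\<integral>\<^sup>+y. f (x + u + y) * ennreal (gauss_density s y) \<partial>lborel) * ennreal (gauss_density h u)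
        = (\<integral>\<^sup>+y. f (x + y) * ennreal (gauss_density s (y - u)) \<partial>lborel) * ennreal (gauss_density h u)"
      using nn_integral_lborel_affine[of "\<lambda>y. f (x + y) * ennreal (gauss_density s (y - u))" 1 u]
      by (simp add: add.assoc)
  qed
  also have "\<dots> = (\<integral>\<^sup>+u. (\<integral>\<^sup>+y. f (x + y) * ennreal (gauss_density s (y - u)) * ennreal (gauss_density h u) \<partial>lborel) \<partial>lborel)"
    by (intro nn_integral_cong nn_integral_multc[symmetric]) auto
  also have "\<dots> = (\<integral>\<^sup>+y. (\<integral>\<^sup>+u. f (x + y) * ennreal (gauss_density s (y - u)) * ennreal (gauss_density h u) \<partial>lborel) \<partial>lborel)"
    by (rule lborel_pair.Fubini') measurable
  also have "\<dots> = (\<integral>\<^sup>+y. f (x + y) * ennreal (gauss_density (s + h) y) \<partial>lborel)"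
  proof (rule nn_integral_cong)
    fix y :: 'a
    define v m where "v = s * h / (s + h)" and "m = h / (s + h)"
    have v: "v > 0" using s h by (simp add: v_def)
    have "(\<integral>\<^sup>+u. f (x + y) * ennreal (gauss_density s (y - u)) * ennreal (gauss_density h u) \<partial>lborel)
       = (\<integral>\<^sup>+u. f (x + y) * ennreal (gauss_density (s + h) y) * ennreal (gauss_density v (u - m *\<^sub>R y)) \<partial>lborel)"
      using gauss_density_convolution[OF s h, of _ y]
      by (intro nn_integral_cong)
         (simp add: mult.assoc ennreal_mult[symmetric] mult.commute[of "gauss_density s _"] v_def m_def)
    also have "\<dots> = f (x + y) * ennreal (gauss_density (s + h) y)"
      by (subst nn_integral_cmult) (auto simp: nn_integral_gauss_density v)
    finally show "(\<integral>\<^sup>+u. f (x + y) * ennreal (gauss_density s (y - u)) * ennreal (gauss_density h u) \<partial>lborel)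
       = f (x + y) * ennreal (gauss_density (s + h) y)" .
  qed
  also have "\<dots> = (\<integral>\<^sup>+z. f (x + sqrt (s + h) *\<^sub>R z) \<partial>std_gauss)"
    using s h by (subst nn_integral_std_gauss_scaled[symmetric]) auto
  finally show ?thesis .
qed

text \<open>Linear exponential moments are finite because shifting by \<open>a\<close> turns \<open>exp (a \<bullet> z)\<close> into a
  constant; the norm is at most \<open>DIM('a)\<close> times one of the coordinates in absolute value, so finitely
  many linear exponentials dominate \<open>exp (c |z|)\<close>.\<close>
lemma integrable_exp_norm_std_gauss:
  "integrable std_gauss (\<lambda>z::'a::euclidean_space. exp (c * norm z))"
proof (rule integrableI_nonneg)
  define k where "k = \<bar>c\<bar> * real DIM('a)"
  have exp_moment: "(\<integral>\<^sup>+z. ennreal (exp (a \<bullet> z)) \<partial>std_gauss) < \<infinity>" for a :: 'a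
    by (subst nn_integral_std_gauss_shift[of _ a])
       (auto simp: ennreal_mult[symmetric] exp_add[symmetric] inner_add_right)
  have le: "exp (c * norm z) \<le> (\<Sum>b\<in>Basis. exp ((k *\<^sub>R b) \<bullet> z) + exp ((- k *\<^sub>R b) \<bullet> z))" for z :: 'a
  proof -
    have "Max ((\<lambda>b. \<bar>z \<bullet> b\<bar>) ` Basis) \<in> (\<lambda>b. \<bar>z \<bullet> b\<bar>) ` Basis"
      by (rule Max_in) auto
    then obtain b where b: "b \<in> Basis" "Max ((\<lambda>b. \<bar>z \<bullet> b\<bar>) ` Basis) = \<bar>z \<bullet> b\<bar>"
      by (rule imageE)
    hence b: "b \<in> Basis" "\<And>b'. b' \<in> Basis \<Longrightarrow> \<bar>z \<bullet> b'\<bar> \<le> \<bar>z \<bullet> b\<bar>"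
      by (auto simp flip: b(2))
    have "norm z \<le> (\<Sum>b\<in>Basis. \<bar>z \<bullet> b\<bar>)" by (rule norm_le_l1)
    also have "\<dots> \<le> real DIM('a) * \<bar>z \<bullet> b\<bar>"
      using b by (intro sum_bounded_above) auto
    finally have "c * norm z \<le> k * \<bar>z \<bullet> b\<bar>"
      unfolding k_def by (smt (verit) abs_ge_self mult.assoc mult_left_mono mult_right_mono norm_ge_zero abs_ge_zero)
    hence "exp (c * norm z) \<le> exp (k * \<bar>z \<bullet> b\<bar>)" by simp
    also have "\<dots> \<le> exp ((k *\<^sub>R b) \<bullet> z) + exp ((- k *\<^sub>R b) \<bullet> z)"
      by (cases "z \<bullet> b \<ge> 0") (auto simp: inner_commute abs_if)
    also have "\<dots> \<le> (\<Sum>b\<in>Basis. exp ((k *\<^sub>R b) \<bullet> z) + exp ((- k *\<^sub>R b) \<bullet> z))"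
      using b by (intro member_le_sum) (auto intro!: add_nonneg_nonneg)
    finally show ?thesis .
  qed
  have "(\<integral>\<^sup>+z. ennreal (exp (c * norm (z::'a))) \<partial>std_gauss)
      \<le> (\<integral>\<^sup>+z. (\<Sum>b\<in>(Basis::'a set). ennreal (exp ((k *\<^sub>R b) \<bullet> z)) + ennreal (exp ((- k *\<^sub>R b) \<bullet> z))) \<partial>std_gauss)"
    by (intro nn_integral_mono order.trans[OF ennreal_leI[OF le]])
       (simp add: sum_ennreal ennreal_plus[symmetric] del: ennreal_plus)
  also have "\<dots> = (\<Sum>b\<in>(Basis::'a set). (\<integral>\<^sup>+z. ennreal (exp ((k *\<^sub>R b) \<bullet> z)) \<partial>std_gauss) + (\<integral>\<^sup>+z. ennreal (exp ((- k *\<^sub>R b) \<bullet> z)) \<partial>std_gauss))"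
    by (subst nn_integral_sum) (auto intro!: sum.cong nn_integral_add)
  also have "\<dots> < \<infinity>"
    using exp_moment[of "k *\<^sub>R _"] exp_moment[of "- k *\<^sub>R _"] by simp
  finally show "(\<integral>\<^sup>+z. ennreal (exp (c * norm (z::'a))) \<partial>std_gauss) < \<infinity>" .
qed auto

lemma integrable_std_gauss_bounded:
  fixes g :: "'a::euclidean_space \<Rightarrow> 'b::{banach, second_countable_topology}"
  assumes "g \<in> borel_measurable borel" "\<And>z. norm (g z) \<le> C * exp (c * norm z)"
  shows "integrable std_gauss g"
  using assms
  by (intro Bochner_Integration.integrable_bound[OF integrable_mult_right[OF integrable_exp_norm_std_gauss[of c], of C]])
     (auto intro!: AE_I2 intro: order.trans[OF _ abs_ge_self])

lemma integral_std_gauss_odd: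
  fixes a :: "'a::euclidean_space"
  shows "integrable std_gauss (\<lambda>z. a \<bullet> z)" "(\<integral>z. a \<bullet> z \<partial>std_gauss) = 0"
proof -
  have b: "norm (a \<bullet> z) \<le> norm a * exp (1 * norm z)" for z
    using exp_ge_add_one_self[of "norm z", THEN order.trans[rotated], of "norm z"]
    by (intro order.trans[OF Cauchy_Schwarz_ineq2[of a z, folded real_norm_def]] mult_left_mono) auto
  show int: "integrable std_gauss (\<lambda>z. a \<bullet> z)"
    by (rule integrable_std_gauss_bounded[OF _ b]) simp
  have dist: "distr std_gauss borel uminus = (std_gauss :: 'a measure)"
  proof (rule measure_eqI)
    fix A assume "A \<in> sets (distr std_gauss borel uminus :: 'a measure)"
    hence [measurable]: "A \<in> sets borel" by simp
    show "emeasure (distr std_gauss borel uminus) A = emeasure (std_gauss::'a measure) A"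
    proof -
      have "emeasure (distr std_gauss borel uminus) A = (\<integral>\<^sup>+z. indicator A z \<partial>distr std_gauss borel uminus)"
        by simp
      also have "\<dots> = (\<integral>\<^sup>+z. indicator A (- z) \<partial>(std_gauss :: 'a measure))"
        by (rule nn_integral_distr) auto
      also have "\<dots> = emeasure std_gauss A"
        using nn_integral_std_gauss_uminus[of "indicator A"] by simp
      finally show ?thesis .
    qed
  qed simp
  have "(\<integral>z. a \<bullet> z \<partial>std_gauss) = (\<integral>z. a \<bullet> z \<partial>(distr std_gauss borel uminus))" by (simp add: dist)
  also have "\<dots> = - (\<integral>z. a \<bullet> z \<partial>std_gauss)" by (subst integral_distr) auto
  finally show "(\<integral>z. a \<bullet> z \<partial>std_gauss) = 0" by simp
qed

section \<open>Log-Lipschitz functions under the heat semigroup\<close>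

definition log_lipschitz :: "real \<Rightarrow> ('a::euclidean_space \<Rightarrow> real) \<Rightarrow> bool" where
  "log_lipschitz K F \<longleftrightarrow> F \<in> borel_measurable borel \<and> (\<forall>x. 0 < F x) \<and>
     (\<forall>x a. F (x + a) \<le> F x * exp (K * norm a))"

definition heat :: "real \<Rightarrow> ('a::euclidean_space \<Rightarrow> real) \<Rightarrow> 'a \<Rightarrow> real" where
  "heat s F x = (\<integral>z. F (x + sqrt s *\<^sub>R z) \<partial>std_gauss)"

text \<open>Gaussian integration by parts puts the derivative on the Gaussian density instead of on \<open>F\<close>; for
  \<open>s > 0\<close> this is the gradient of \<open>heat s F\<close>, see \<open>gderiv_heat\<close>.\<close>
definition heat_grad :: "real \<Rightarrow> ('a::euclidean_space \<Rightarrow> real) \<Rightarrow> 'a \<Rightarrow> 'a" where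
  "heat_grad s F x = (1 / sqrt s) *\<^sub>R (\<integral>z. F (x + sqrt s *\<^sub>R z) *\<^sub>R z \<partial>std_gauss)"

lemma le_exp_self: "t \<le> exp (t::real)"
  using exp_ge_add_one_self[of t] by linarith

lemma square_le_exp: "0 \<le> t \<Longrightarrow> t\<^sup>2 \<le> 2 * exp (t::real)"
  using exp_lower_Taylor_quadratic[of t] by simp

lemma abs_exp_minus_one_le: "\<bar>exp p - 1\<bar> \<le> \<bar>p\<bar> * exp \<bar>p::real\<bar>"
proof (cases "p \<ge> 0")
  case True
  have "1 - p \<le> exp (- p)" using exp_ge_add_one_self[of "-p"] by simp
  hence "(1 - p) * exp p \<le> exp (- p) * exp p" by (intro mult_right_mono) auto
  hence "exp p - 1 \<le> p * exp p" by (simp add: exp_add[symmetric] algebra_simps)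
  with True show ?thesis by simp
next
  case False
  have "1 - exp p \<le> - p * 1" using exp_ge_add_one_self[of p] by linarith
  also have "\<dots> \<le> - p * exp (-p)" using False by (intro mult_left_mono) auto
  finally show ?thesis using False by simp
qed

text \<open>Both signs of \<open>p\<close> at once: \<open>0 \<le> exp p - 1 - p \<le> p (exp p - 1)\<close>, the second inequality being
  a form of \<open>1 - p \<le> exp (- p)\<close>.\<close>
lemma exp_taylor_remainder: "\<bar>exp p - 1 - p\<bar> \<le> p\<^sup>2 * exp \<bar>p::real\<bar>"
proof -
  have "1 - p \<le> exp (- p)" using exp_ge_add_one_self[of "-p"] by simp
  hence "(1 - p) * exp p \<le> exp (- p) * exp p" by (intro mult_right_mono) auto
  hence "exp p - 1 \<le> p * exp p" by (simp add: exp_add[symmetric] algebra_simps)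
  moreover have "0 \<le> exp p - 1 - p" using exp_ge_add_one_self[of p] by linarith
  ultimately have "\<bar>exp p - 1 - p\<bar> \<le> p * (exp p - 1)" by (simp add: algebra_simps)
  also have "\<dots> \<le> \<bar>p\<bar> * \<bar>exp p - 1\<bar>" by (simp add: abs_mult[symmetric])
  also have "\<dots> \<le> \<bar>p\<bar> * (\<bar>p\<bar> * exp \<bar>p\<bar>)" by (intro mult_left_mono abs_exp_minus_one_le) auto
  finally show ?thesis by (simp add: power2_eq_square)
qed

text \<open>The exponential \<open>exp (\<alpha> \<bullet> z - |\<alpha>|\<^sup>2/2)\<close> is the density of a shifted Gaussian; up to second
  order in \<open>\<alpha>\<close> it is \<open>1 + \<alpha> \<bullet> z\<close>, and like it has mean 1. The constant only has to be uniform for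
  \<open>|\<alpha>| \<le> R\<close>, at the price of exponential growth in \<open>z\<close>, which Gaussian integrals absorb.\<close>
lemma exp_martingale_remainder:
  fixes \<alpha> z :: "'a::real_inner"
  assumes "norm \<alpha> \<le> R"
  shows "\<bar>exp (\<alpha> \<bullet> z - (norm \<alpha>)\<^sup>2 / 2) - 1 - \<alpha> \<bullet> z\<bar> \<le> 3 * (norm \<alpha>)\<^sup>2 * exp ((R + 1) * (norm z + R))"
proof -
  define p where "p = \<alpha> \<bullet> z - (norm \<alpha>)\<^sup>2 / 2"
  define t where "t = norm z + R"
  have R: "R \<ge> 0" using assms norm_ge_zero order.trans by blast
  have t: "t \<ge> 0" using R by (simp add: t_def)
  have "(norm \<alpha>)\<^sup>2 \<le> norm \<alpha> * R"
    using mult_left_mono[OF assms norm_ge_zero[of \<alpha>]] by (simp add: power2_eq_square)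
  hence p: "\<bar>p\<bar> \<le> norm \<alpha> * t"
    using Cauchy_Schwarz_ineq2[of \<alpha> z] zero_le_power2[of "norm \<alpha>"]
    unfolding p_def t_def distrib_left by linarith
  have pR: "\<bar>p\<bar> \<le> R * t"
    using p mult_right_mono[OF assms t] by linarith
  have p2: "p\<^sup>2 \<le> (norm \<alpha> * t)\<^sup>2"
    using power_mono[OF p, of 2] by simp
  have "p\<^sup>2 * exp \<bar>p\<bar> \<le> (norm \<alpha> * t)\<^sup>2 * exp (R * t)"
    using p2 pR by (intro mult_mono) auto
  also have "\<dots> \<le> (norm \<alpha>)\<^sup>2 * (2 * exp t) * exp (R * t)"
    unfolding power_mult_distrib by (intro mult_right_mono mult_left_mono square_le_exp t) auto
  also have "\<dots> = 2 * (norm \<alpha>)\<^sup>2 * exp ((R + 1) * t)"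
    by (simp add: exp_add[symmetric] algebra_simps)
  finally have "\<bar>exp p - 1 - p\<bar> \<le> 2 * (norm \<alpha>)\<^sup>2 * exp ((R + 1) * t)"
    using exp_taylor_remainder[of p] by linarith
  moreover have "(norm \<alpha>)\<^sup>2 / 2 \<le> (norm \<alpha>)\<^sup>2 * exp ((R + 1) * t)"
    using R t mult_left_mono[of 1 "exp ((R + 1) * t)" "(norm \<alpha>)\<^sup>2"]
      zero_le_power2[of "norm \<alpha>"] by (simp del: zero_le_power2, linarith)
  ultimately have "\<bar>exp p - 1 - p\<bar> + (norm \<alpha>)\<^sup>2 / 2 \<le> 3 * (norm \<alpha>)\<^sup>2 * exp ((R + 1) * t)"
    by linarith
  moreover have "exp p - 1 - \<alpha> \<bullet> z = (exp p - 1 - p) - (norm \<alpha>)\<^sup>2 / 2" by (simp add: p_def)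
  ultimately have "\<bar>exp p - 1 - \<alpha> \<bullet> z\<bar> \<le> 3 * (norm \<alpha>)\<^sup>2 * exp ((R + 1) * t)"
    using zero_le_power2[of "norm \<alpha>"] by linarith
  thus ?thesis by (simp add: p_def t_def)
qed

lemma integral_std_gauss_le:
  fixes g :: "'a::euclidean_space \<Rightarrow> 'b::{banach, second_countable_topology}"
  assumes "g \<in> borel_measurable borel" "\<And>z. norm (g z) \<le> C * exp (c * norm z)"
  shows "norm (\<integral>z. g z \<partial>std_gauss) \<le> C * (\<integral>z. exp (c * norm z) \<partial>(std_gauss::'a measure))"
proof -
  have "norm (\<integral>z. g z \<partial>std_gauss) \<le> (\<integral>z. norm (g z) \<partial>std_gauss)"
    by (rule integral_norm_bound)
  also have "\<dots> \<le> (\<integral>z. C * exp (c * norm z) \<partial>(std_gauss::'a measure))"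
  proof (rule integral_mono)
    show "integrable std_gauss (\<lambda>z. norm (g z))"
      by (rule integrable_norm) (rule integrable_std_gauss_bounded[OF assms])
    show "integrable std_gauss (\<lambda>z::'a. C * exp (c * norm z))"
      by (intro integrable_mult_right integrable_exp_norm_std_gauss)
  qed (rule assms)
  finally show ?thesis by simp
qed

lemma integral_std_gauss_shift:
  fixes f :: "'a::euclidean_space \<Rightarrow> real"
  assumes [measurable]: "f \<in> borel_measurable borel" and "\<And>z. f z \<ge> 0"
  shows "(\<integral>z. f z \<partial>std_gauss) = (\<integral>z. f (z + a) * exp (- (a \<bullet> z) - (norm a)\<^sup>2 / 2) \<partial>std_gauss)"
  using assms nn_integral_std_gauss_shift[of "\<lambda>z. ennreal (f z)" a]
  by (simp add: integral_eq_nn_integral ennreal_mult)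

lemma integral_exp_martingale:
  fixes \<alpha> :: "'a::euclidean_space"
  shows "integrable std_gauss (\<lambda>z. exp (\<alpha> \<bullet> z - (norm \<alpha>)\<^sup>2 / 2))"
    and "(\<integral>z. exp (\<alpha> \<bullet> z - (norm \<alpha>)\<^sup>2 / 2) \<partial>std_gauss) = 1"
proof -
  have "norm (exp (\<alpha> \<bullet> z - (norm \<alpha>)\<^sup>2 / 2)) \<le> 1 * exp (norm \<alpha> * norm z)" for z
    using Cauchy_Schwarz_ineq2[of \<alpha> z] zero_le_power2[of "norm \<alpha>"]
    by (simp del: zero_le_power2, linarith)
  thus "integrable std_gauss (\<lambda>z. exp (\<alpha> \<bullet> z - (norm \<alpha>)\<^sup>2 / 2))"
    by (intro integrable_std_gauss_bounded[of _ 1 "norm \<alpha>"]) simp_all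
  show "(\<integral>z. exp (\<alpha> \<bullet> z - (norm \<alpha>)\<^sup>2 / 2) \<partial>std_gauss) = 1"
    by (subst integral_std_gauss_shift[of _ \<alpha>])
       (auto simp: exp_add[symmetric] inner_add_right power2_norm_eq_inner std_gauss.prob_space[simplified])
qed

context
  fixes K :: real and F :: "'a::euclidean_space \<Rightarrow> real"
  assumes K: "K \<ge> 0" and F: "log_lipschitz K F"
begin

lemma log_lipschitzD:
  shows "F \<in> borel_measurable borel" "0 < F x" "F (x + a) \<le> F x * exp (K * norm a)"
  using F by (auto simp: log_lipschitz_def)

lemma log_lipschitz_lower: "F x * exp (- (K * norm a)) \<le> F (x + a)"
proof -
  have "F x \<le> F (x + a) * exp (K * norm a)"
    using log_lipschitzD(3)[of "x + a" "- a"] by simp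
  thus ?thesis by (simp add: exp_minus field_simps)
qed

lemma log_lipschitz_diff: "\<bar>F (x + a) - F x\<bar> \<le> F x * (K * norm a) * exp (K * norm a)"
proof -
  define t where "t = K * norm a"
  have t: "t \<ge> 0" using K by (simp add: t_def)
  have "F (x + a) - F x \<le> F x * (exp t - 1)"
    using log_lipschitzD(3)[of x a] by (simp add: t_def algebra_simps)
  also have "\<dots> \<le> F x * (t * exp t)"
    using abs_exp_minus_one_le[of t] log_lipschitzD(2)[of x] t by (intro mult_left_mono) auto
  finally have 1: "F (x + a) - F x \<le> F x * t * exp t" by simp
  have "F x - F (x + a) \<le> F x * (1 - exp (- t))"
    using log_lipschitz_lower[of x a] by (simp add: t_def algebra_simps)
  also have "\<dots> \<le> F x * (t * exp t)"
    using abs_exp_minus_one_le[of "- t"] log_lipschitzD(2)[of x] t by (intro mult_left_mono) auto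
  finally show ?thesis using 1 by (simp add: t_def)
qed

lemma log_lipschitz_integrable:
  "integrable std_gauss (\<lambda>z. F (x + c *\<^sub>R z))"
  "integrable std_gauss (\<lambda>z. F (x + c *\<^sub>R z) *\<^sub>R z)"
proof -
  note [measurable] = log_lipschitzD(1)
  have 1: "F (x + c *\<^sub>R z) \<le> F x * exp (K * \<bar>c\<bar> * norm z)" for z
    using log_lipschitzD(3)[of x "c *\<^sub>R z"] by (simp add: mult.assoc)
  show "integrable std_gauss (\<lambda>z. F (x + c *\<^sub>R z))"
    by (rule integrable_std_gauss_bounded[of _ "F x" "K * \<bar>c\<bar>"])
       (use 1 log_lipschitzD(2) in \<open>auto simp: less_imp_le\<close>)
  have "F (x + c *\<^sub>R z) * norm z \<le> F x * exp (K * \<bar>c\<bar> * norm z) * exp (norm z)" for z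
    using 1 log_lipschitzD(2) by (intro mult_mono le_exp_self) (auto simp: less_imp_le)
  hence "norm (F (x + c *\<^sub>R z) *\<^sub>R z) \<le> F x * exp ((K * \<bar>c\<bar> + 1) * norm z)" for z
    using log_lipschitzD(2)[of "x + c *\<^sub>R z"] by (simp add: distrib_right exp_add mult.assoc)
  thus "integrable std_gauss (\<lambda>z. F (x + c *\<^sub>R z) *\<^sub>R z)"
    by (intro integrable_std_gauss_bounded[of _ "F x" "K * \<bar>c\<bar> + 1"]) auto
qed

lemma heat_measurable [measurable]:
  "heat s F \<in> borel_measurable borel" "heat_grad s F \<in> borel_measurable borel"
proof -
  note [measurable] = log_lipschitzD(1)
  show "heat s F \<in> borel_measurable borel" "heat_grad s F \<in> borel_measurable borel"
    unfolding heat_def heat_grad_def by measurable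
qed

lemma ennreal_heat: "ennreal (heat s F x) = (\<integral>\<^sup>+z. ennreal (F (x + sqrt s *\<^sub>R z)) \<partial>std_gauss)"
  unfolding heat_def
  by (rule nn_integral_eq_integral[symmetric])
     (auto intro: log_lipschitz_integrable less_imp_le[OF log_lipschitzD(2)])

lemma log_lipschitz_le_heat:
  assumes s: "0 \<le> s" "s \<le> T"
  shows "F x * (\<integral>z. exp (- (K * sqrt T) * norm z) \<partial>(std_gauss::'a measure)) \<le> heat s F x"
proof -
  have "F x * exp (- (K * sqrt T) * norm z) \<le> F (x + sqrt s *\<^sub>R z)" for z
  proof -
    have "F x * exp (- (K * sqrt T) * norm z) \<le> F x * exp (- (K * norm (sqrt s *\<^sub>R z)))"
    proof -
      have "K * (sqrt s * norm z) \<le> K * (sqrt T * norm z)"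
        using s K by (intro mult_left_mono mult_right_mono) auto
      thus ?thesis using s log_lipschitzD(2)[of x] by (simp add: mult.assoc)
    qed
    also have "\<dots> \<le> F (x + sqrt s *\<^sub>R z)" by (rule log_lipschitz_lower)
    finally show ?thesis .
  qed
  hence "(\<integral>z. F x * exp (- (K * sqrt T) * norm z) \<partial>(std_gauss::'a measure)) \<le> heat s F x"
    unfolding heat_def
    by (intro integral_mono log_lipschitz_integrable integrable_mult_right integrable_exp_norm_std_gauss)
  thus ?thesis by simp
qed

end

lemma integral_exp_norm_pos: "0 < (\<integral>z. exp (c * norm z) \<partial>(std_gauss::'a::euclidean_space measure))"
proof -
  have "(\<integral>z. exp (c * norm z) \<partial>(std_gauss::'a measure)) \<noteq> 0"
    by (subst integral_nonneg_eq_0_iff_AE) (auto intro!: integrable_exp_norm_std_gauss simp: std_gauss.AE_False)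
  moreover have "0 \<le> (\<integral>z. exp (c * norm z) \<partial>(std_gauss::'a measure))" by simp
  ultimately show ?thesis by linarith
qed

lemma log_lipschitz_heat:
  assumes K: "K \<ge> 0" and F: "log_lipschitz K F" and s: "s \<ge> 0"
  shows "log_lipschitz K (heat s F)"
  unfolding log_lipschitz_def
proof (intro conjI allI)
  show "heat s F \<in> borel_measurable borel" using heat_measurable[OF K F] by simp
  show "0 < heat s F x" for x
    by (rule less_le_trans[OF _ log_lipschitz_le_heat[OF K F s order.refl]])
       (intro mult_pos_pos log_lipschitzD(2)[OF K F] integral_exp_norm_pos)
  fix x a
  have "heat s F (x + a) \<le> (\<integral>z. F (x + sqrt s *\<^sub>R z) * exp (K * norm a) \<partial>std_gauss)"
    unfolding heat_def
    using log_lipschitzD(3)[OF K F, of "x + sqrt s *\<^sub>R _" a]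
    by (intro integral_mono log_lipschitz_integrable[OF K F] integrable_mult_left) (simp add: add_ac)
  thus "heat s F (x + a) \<le> heat s F x * exp (K * norm a)" by (simp add: heat_def)
qed

lemma heat_zero [simp]: "heat 0 F = F"
  by (rule ext) (simp add: heat_def std_gauss.prob_space[simplified])

lemma heat_heat:
  assumes K: "K \<ge> 0" and F: "log_lipschitz K F" and s: "s \<ge> 0" and h: "h \<ge> 0"
  shows "heat h (heat s F) x = heat (s + h) F x"
proof -
  note [measurable] = log_lipschitzD(1)[OF K F]
  have G: "log_lipschitz K (heat s F)" by (rule log_lipschitz_heat[OF K F s])
  have "ennreal (heat h (heat s F) x) = ennreal (heat (s + h) F x)"
    unfolding ennreal_heat[OF K G] ennreal_heat[OF K F]
    by (rule nn_integral_std_gauss_semigroup) (use s h in auto)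
  moreover have "0 \<le> heat h (heat s F) x" "0 \<le> heat (s + h) F x"
    using log_lipschitzD(2)[OF K log_lipschitz_heat[OF K G h], of x]
      log_lipschitzD(2)[OF K log_lipschitz_heat[OF K F], of "s + h" x] s h by auto
  ultimately show ?thesis by simp
qed

text \<open>The relative bound need not be small on long segments, so the segment from \<open>x\<close> to \<open>x + a\<close>
  is cut into \<open>N\<close> pieces, on each of which the relative increment \<open>d\<close> is at most \<open>1/2\<close>. There the
  ratio of consecutive values is at most \<open>(1 + d)/(1 - d) \<le> 1 + 4 d\<close>, which is where the factor 4
  comes from.\<close>
lemma log_lipschitz_of_relative_bound:
  fixes F :: "'a::euclidean_space \<Rightarrow> real"
  assumes meas: "F \<in> borel_measurable borel" and pos: "\<And>x. F x > 0" and L: "L \<ge> 0"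
    and rel: "\<And>x y. \<bar>F x - F y\<bar> \<le> L * (F x + F y) * norm (x - y)"
  shows "log_lipschitz (4 * L) F"
  unfolding log_lipschitz_def
proof (intro conjI allI meas pos)
  fix x a :: 'a
  obtain N :: nat where N: "2 * L * norm a < real N" using reals_Archimedean2 by blast
  have "0 \<le> 2 * L * norm a" using L by simp
  hence N0: "N > 0" using N by (intro gr0I) simp
  define d where "d = L * norm a / real N"
  have d: "0 \<le> d" "d \<le> 1 / 2" using L N N0 by (auto simp: d_def field_simps)
  have "F (x + (real k / real N) *\<^sub>R a) \<le> F x * exp (4 * d) ^ k" for k
  proof (induction k)
    case 0
    show ?case by simp
  next
    case (Suc k)
    define y y' where "y = x + (real k / real N) *\<^sub>R a" and "y' = x + (real (Suc k) / real N) *\<^sub>R a"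
    have "y' - y = (1 / real N) *\<^sub>R a"
      by (simp add: y_def y'_def scaleR_diff_left[symmetric] diff_divide_distrib[symmetric])
    hence Ld: "L * norm (y' - y) = d" by (simp add: d_def)
    have "F y' - F y \<le> (L * norm (y' - y)) * (F y' + F y)" using rel[of y' y] by (simp add: mult_ac)
    hence "F y' - F y \<le> d * (F y' + F y)" unfolding Ld .
    hence "F y' * (1 - d) \<le> F y * (1 + d)" by (simp add: algebra_simps)
    also have "\<dots> \<le> F y * ((1 + 4 * d) * (1 - d))"
    proof -
      have "d * d \<le> d * (1 / 2)" using d by (intro mult_left_mono) auto
      thus ?thesis using pos[of y] by (intro mult_left_mono) (auto simp: algebra_simps)
    qed
    finally have "F y' * (1 - d) \<le> (F y * (1 + 4 * d)) * (1 - d)" by (simp add: mult_ac)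
    hence "F y' \<le> F y * (1 + 4 * d)" using d by (simp only: mult_le_cancel_right_pos)
    also have "\<dots> \<le> F y * exp (4 * d)"
      using pos[of y] exp_ge_add_one_self[of "4 * d"] by (intro mult_left_mono) auto
    also have "\<dots> \<le> F x * exp (4 * d) ^ k * exp (4 * d)"
      using Suc.IH by (intro mult_right_mono) (auto simp: y_def)
    finally show ?case by (simp add: y'_def mult_ac)
  qed
  from this[of N] have "F (x + a) \<le> F x * exp (real N * (4 * d))"
    using N0 by (simp add: exp_of_nat_mult)
  also have "real N * (4 * d) = 4 * L * norm a" using N0 by (simp add: d_def)
  finally show "F (x + a) \<le> F x * exp (4 * L * norm a)" .
qed

text \<open>Because of the constant 1 in the growth condition, \<open>\<phi>\<close> may vanish and then is not log-Lipschitz.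
  Mixing in \<open>\<epsilon>\<close> repairs this: the mixture is at least \<open>\<epsilon>\<close>, so 1 is at most \<open>1/\<epsilon>\<close> times its
  value.\<close>
lemma log_lipschitz_mixture:
  fixes \<phi> :: "'a::euclidean_space \<Rightarrow> real"
  assumes [measurable]: "\<phi> \<in> borel_measurable borel" and nn: "\<And>x. \<phi> x \<ge> 0"
    and \<epsilon>: "0 < \<epsilon>" "\<epsilon> < 1" and C: "C > 0"
    and rel: "\<And>x y. \<bar>\<phi> x - \<phi> y\<bar> \<le> C * (1 + \<phi> x + \<phi> y) * norm (x - y)"
  shows "log_lipschitz (4 * (C * (1 + 1 / \<epsilon>))) (\<lambda>y. (1 - \<epsilon>) * \<phi> y + \<epsilon>)"
proof (rule log_lipschitz_of_relative_bound)
  define F where "F = (\<lambda>y. (1 - \<epsilon>) * \<phi> y + \<epsilon>)"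
  have F_ge: "F y \<ge> \<epsilon>" for y using \<epsilon> nn[of y] by (simp add: F_def)
  show "0 < (1 - \<epsilon>) * \<phi> x + \<epsilon>" for x using F_ge[of x] \<epsilon> by (simp add: F_def)
  show "0 \<le> C * (1 + 1 / \<epsilon>)" using C \<epsilon> by simp
  fix x y
  have "(1 - \<epsilon>) * (1 + \<phi> x + \<phi> y) \<le> 1 + (F x + F y)"
    using \<epsilon> by (simp add: F_def algebra_simps)
  also have "\<dots> \<le> (1 + 1 / \<epsilon>) * (F x + F y)"
  proof -
    have "1 \<le> (F x + F y) / \<epsilon>" using F_ge[of x] F_ge[of y] \<epsilon> by (simp add: field_simps)
    thus ?thesis by (simp add: algebra_simps add_divide_distrib)
  qed
  finally have *: "(1 - \<epsilon>) * (1 + \<phi> x + \<phi> y) \<le> (1 + 1 / \<epsilon>) * (F x + F y)" .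
  have "F x - F y = (1 - \<epsilon>) * (\<phi> x - \<phi> y)" by (simp add: F_def algebra_simps)
  hence "\<bar>F x - F y\<bar> = (1 - \<epsilon>) * \<bar>\<phi> x - \<phi> y\<bar>" using \<epsilon> by (simp add: abs_mult)
  also have "\<dots> \<le> (1 - \<epsilon>) * (C * (1 + \<phi> x + \<phi> y) * norm (x - y))"
    using \<epsilon> by (intro mult_left_mono rel) auto
  also have "\<dots> = C * ((1 - \<epsilon>) * (1 + \<phi> x + \<phi> y)) * norm (x - y)" by simp
  also have "\<dots> \<le> C * ((1 + 1 / \<epsilon>) * (F x + F y)) * norm (x - y)"
    using C by (intro mult_right_mono mult_left_mono *) auto
  finally show "\<bar>((1 - \<epsilon>) * \<phi> x + \<epsilon>) - ((1 - \<epsilon>) * \<phi> y + \<epsilon>)\<bar>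
      \<le> C * (1 + 1 / \<epsilon>) * (((1 - \<epsilon>) * \<phi> x + \<epsilon>) + ((1 - \<epsilon>) * \<phi> y + \<epsilon>)) * norm (x - y)"
    by (simp add: F_def mult.assoc)
qed measurable

section \<open>First-order expansion of the heat flow\<close>

text \<open>Moves the increment \<open>a\<close> of the argument from \<open>F\<close> to the Gaussian weight. This is why
  \<open>heat s F\<close> is smooth even though \<open>F\<close> is only log-Lipschitz.\<close>
lemma heat_shift:
  assumes K: "K \<ge> 0" and F: "log_lipschitz K F" and s: "s > 0"
  shows "heat s F (x + a)
       = (\<integral>z. F (x + sqrt s *\<^sub>R z) * exp ((1 / sqrt s) *\<^sub>R a \<bullet> z - (norm ((1 / sqrt s) *\<^sub>R a))\<^sup>2 / 2) \<partial>std_gauss)"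
proof -
  note [measurable] = log_lipschitzD(1)[OF K F]
  define \<alpha> where "\<alpha> = (1 / sqrt s) *\<^sub>R a"
  have a: "sqrt s *\<^sub>R \<alpha> = a" using s by (simp add: \<alpha>_def)
  have "(\<integral>z. F (x + sqrt s *\<^sub>R z) * exp (\<alpha> \<bullet> z - (norm \<alpha>)\<^sup>2 / 2) \<partial>std_gauss)
     = (\<integral>z. F (x + sqrt s *\<^sub>R (z + \<alpha>)) * exp (\<alpha> \<bullet> (z + \<alpha>) - (norm \<alpha>)\<^sup>2 / 2)
            * exp (- (\<alpha> \<bullet> z) - (norm \<alpha>)\<^sup>2 / 2) \<partial>std_gauss)"
    by (rule integral_std_gauss_shift) (auto intro!: mult_nonneg_nonneg less_imp_le[OF log_lipschitzD(2)[OF K F]])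
  also have "\<dots> = (\<integral>z. F (x + a + sqrt s *\<^sub>R z) \<partial>std_gauss)"
    by (simp add: mult.assoc exp_add[symmetric] inner_add_right power2_norm_eq_inner scaleR_add_right a add_ac)
  finally show ?thesis by (simp add: heat_def \<alpha>_def)
qed

text \<open>As \<open>z\<close> is centred, \<open>F (x + \<surd>s z)\<close> may be replaced by its increment from \<open>F x\<close>, which is of
  relative size \<open>\<surd>s\<close> and cancels the factor \<open>1/\<surd>s\<close> of the gradient formula.\<close>
lemma heat_grad_bound:
  fixes x :: "'a::euclidean_space"
  assumes K: "K \<ge> 0" and F: "log_lipschitz K F" and s: "0 < s" "s \<le> T"
  shows "norm (heat_grad s F x)
       \<le> 2 * K * F x * (\<integral>z. exp ((K * sqrt T + 1) * norm z) \<partial>(std_gauss::'a measure))"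
    (is "_ \<le> _ * ?m")
proof -
  note [measurable] = log_lipschitzD(1)[OF K F]
  have z0: "(\<integral>z. z \<partial>(std_gauss::'a measure)) = 0"
  proof -
    have i: "integrable std_gauss (\<lambda>z::'a. z)"
      by (rule integrable_std_gauss_bounded[of _ 1 1]) (auto intro: le_exp_self)
    show ?thesis
    proof (rule euclidean_eqI)
      fix b :: 'a
      have "(\<integral>z. z \<partial>std_gauss) \<bullet> b = (\<integral>z. z \<bullet> b \<partial>std_gauss)"
        by (rule integral_inner_left[symmetric]) (rule i)
      thus "(\<integral>z. z \<partial>std_gauss) \<bullet> b = 0 \<bullet> b"
        using integral_std_gauss_odd(2)[of b] by (simp add: inner_commute)
    qed
  qed
  have i: "integrable std_gauss (\<lambda>z::'a. F x *\<^sub>R z)"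
    by (intro integrable_scaleR_right integrable_std_gauss_bounded[of _ 1 1]) (auto intro: le_exp_self)
  have "heat_grad s F x = (1 / sqrt s) *\<^sub>R (\<integral>z. (F (x + sqrt s *\<^sub>R z) - F x) *\<^sub>R z \<partial>std_gauss)"
    unfolding heat_grad_def scaleR_diff_left
    by (subst Bochner_Integration.integral_diff[OF log_lipschitz_integrable(2)[OF K F] i]) (simp add: z0)
  moreover have "norm (\<integral>z. (F (x + sqrt s *\<^sub>R z) - F x) *\<^sub>R z \<partial>std_gauss) \<le> (2 * K * sqrt s * F x) * ?m"
  proof (rule integral_std_gauss_le)
    fix z :: 'a
    have "\<bar>F (x + sqrt s *\<^sub>R z) - F x\<bar> \<le> F x * (K * (sqrt s * norm z)) * exp (K * (sqrt s * norm z))"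
      using log_lipschitz_diff[OF K F, of x "sqrt s *\<^sub>R z"] s by simp
    hence "norm ((F (x + sqrt s *\<^sub>R z) - F x) *\<^sub>R z) \<le> F x * (K * (sqrt s * norm z)) * exp (K * (sqrt s * norm z)) * norm z"
      by (simp add: mult_right_mono)
    also have "\<dots> = (K * sqrt s * F x) * ((norm z)\<^sup>2 * exp (K * (sqrt s * norm z)))"
      by (simp add: power2_eq_square mult_ac)
    also have "\<dots> \<le> (K * sqrt s * F x) * ((2 * exp (norm z)) * exp (K * (sqrt T * norm z)))"
      using K s log_lipschitzD(2)[OF K F, of x]
      by (intro mult_left_mono mult_mono square_le_exp) (auto intro!: mult_left_mono mult_right_mono mult_nonneg_nonneg)
    also have "\<dots> = (2 * K * sqrt s * F x) * exp ((K * sqrt T + 1) * norm z)"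
      by (simp add: exp_add[symmetric] algebra_simps)
    finally show "norm ((F (x + sqrt s *\<^sub>R z) - F x) *\<^sub>R z)
        \<le> (2 * K * sqrt s * F x) * exp ((K * sqrt T + 1) * norm z)" .
  qed simp
  ultimately show ?thesis using s by (simp add: field_simps)
qed

text \<open>By the shift formula the remainder is \<open>E F (x + \<surd>s z) r(z)\<close>, where \<open>r\<close> is the second-order
  remainder of the exponential density at \<open>\<alpha> = a/\<surd>s\<close>. As \<open>E r = 0\<close>, again only the increment of \<open>F\<close>
  counts. Its relative size \<open>\<surd>s\<close> times \<open>|r| = O(|a|\<^sup>2/s)\<close> gives the order \<open>|a|\<^sup>2/\<surd>s\<close>, where \<open>|a|\<^sup>2/s\<close>
  would be the order for merely bounded functions. The condition \<open>|a| \<le> \<surd>s\<close> keeps \<open>\<alpha>\<close> bounded.\<close>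
lemma heat_remainder_small:
  fixes x :: "'a::euclidean_space"
  assumes K: "K \<ge> 0" and F: "log_lipschitz K F" and s: "0 < s" "s \<le> T" and a: "norm a \<le> sqrt s"
  shows "\<bar>heat s F (x + a) - heat s F x - a \<bullet> heat_grad s F x\<bar>
       \<le> 3 * K * F x * ((norm a)\<^sup>2 / sqrt s)
          * (exp 2 * (\<integral>z. exp ((K * sqrt T + 3) * norm z) \<partial>(std_gauss::'a measure)))"
    (is "_ \<le> _ * (exp 2 * ?m)")
proof -
  note [measurable] = log_lipschitzD(1)[OF K F]
  define \<alpha> where "\<alpha> = (1 / sqrt s) *\<^sub>R a"
  define r where "r z = exp (\<alpha> \<bullet> z - (norm \<alpha>)\<^sup>2 / 2) - 1 - \<alpha> \<bullet> z" for z
  have \<alpha>: "norm \<alpha> \<le> 1" "(norm \<alpha>)\<^sup>2 = (norm a)\<^sup>2 / s"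
    using a s by (auto simp: \<alpha>_def power_divide)
  have [measurable]: "r \<in> borel_measurable borel" unfolding r_def by measurable
  have r: "\<bar>r z\<bar> \<le> 3 * (norm \<alpha>)\<^sup>2 * exp (2 * (norm z + 1))" for z
    unfolding r_def using exp_martingale_remainder[OF \<alpha>(1), of z] by simp
  have ir: "integrable std_gauss r" and r0: "(\<integral>z. r z \<partial>std_gauss) = 0"
    unfolding r_def
    using integral_exp_martingale[of \<alpha>] integral_std_gauss_odd[of \<alpha>] std_gauss.prob_space[where 'a='a]
    by simp_all
  have e: "(F (x + sqrt s *\<^sub>R z) - F x) * r z
     = F (x + sqrt s *\<^sub>R z) * exp (\<alpha> \<bullet> z - (norm \<alpha>)\<^sup>2 / 2) - F (x + sqrt s *\<^sub>R z)
       - a \<bullet> ((1 / sqrt s) *\<^sub>R (F (x + sqrt s *\<^sub>R z) *\<^sub>R z)) - F x * r z" for z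
    unfolding r_def \<alpha>_def by (simp add: algebra_simps)
  have bound: "norm ((F (x + sqrt s *\<^sub>R z) - F x) * r z)
      \<le> (3 * K * F x * ((norm a)\<^sup>2 / sqrt s) * exp 2) * exp ((K * sqrt T + 3) * norm z)" for z
  proof -
    have "\<bar>F (x + sqrt s *\<^sub>R z) - F x\<bar> \<le> F x * (K * (sqrt s * norm z)) * exp (K * (sqrt s * norm z))"
      using log_lipschitz_diff[OF K F, of x "sqrt s *\<^sub>R z"] s by simp
    also have "\<dots> \<le> F x * (K * (sqrt s * exp (norm z))) * exp (K * (sqrt T * norm z))"
      using K s log_lipschitzD(2)[OF K F, of x]
      by (intro mult_mono order.refl) (auto intro!: mult_left_mono mult_right_mono mult_nonneg_nonneg le_exp_self)
    finally have "norm ((F (x + sqrt s *\<^sub>R z) - F x) * r z)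
       \<le> (F x * (K * (sqrt s * exp (norm z))) * exp (K * (sqrt T * norm z)))
         * (3 * (norm \<alpha>)\<^sup>2 * exp (2 * (norm z + 1)))"
      using r[of z] unfolding real_norm_def abs_mult by (intro mult_mono) auto
    also have "\<dots> = (3 * K * F x * (sqrt s * (norm \<alpha>)\<^sup>2) * exp 2) * exp ((K * sqrt T + 3) * norm z)"
    proof -
      have "exp (norm z) * exp (K * (sqrt T * norm z)) * exp (2 * (norm z + 1))
          = exp 2 * exp ((K * sqrt T + 3) * norm z)"
        by (simp add: exp_add[symmetric] algebra_simps)
      moreover have "(F x * (K * (sqrt s * exp (norm z))) * exp (K * (sqrt T * norm z)))
         * (3 * (norm \<alpha>)\<^sup>2 * exp (2 * (norm z + 1)))
         = 3 * K * F x * (sqrt s * (norm \<alpha>)\<^sup>2)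
           * (exp (norm z) * exp (K * (sqrt T * norm z)) * exp (2 * (norm z + 1)))"
        by (simp only: mult_ac)
      ultimately show ?thesis by (simp only: mult_ac)
    qed
    also have "sqrt s * (norm \<alpha>)\<^sup>2 = (norm a)\<^sup>2 / sqrt s"
      using s unfolding \<alpha>(2) by (simp add: field_simps)
    finally show ?thesis .
  qed
  have i1: "integrable std_gauss (\<lambda>z. (F (x + sqrt s *\<^sub>R z) - F x) * r z)"
    by (rule integrable_std_gauss_bounded[OF _ bound]) simp
  have ig: "integrable std_gauss (\<lambda>z. a \<bullet> ((1 / sqrt s) *\<^sub>R (F (x + sqrt s *\<^sub>R z) *\<^sub>R z)))"
    by (intro integrable_inner_right integrable_scaleR_right log_lipschitz_integrable[OF K F])
  have iF: "integrable std_gauss (\<lambda>z. F (x + sqrt s *\<^sub>R z))"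
    by (rule log_lipschitz_integrable[OF K F])
  have ie: "integrable std_gauss (\<lambda>z. F (x + sqrt s *\<^sub>R z) * exp (\<alpha> \<bullet> z - (norm \<alpha>)\<^sup>2 / 2))"
  proof -
    have "(\<lambda>z. F (x + sqrt s *\<^sub>R z) * exp (\<alpha> \<bullet> z - (norm \<alpha>)\<^sup>2 / 2))
      = (\<lambda>z. (F (x + sqrt s *\<^sub>R z) - F x) * r z + F (x + sqrt s *\<^sub>R z)
       + a \<bullet> ((1 / sqrt s) *\<^sub>R (F (x + sqrt s *\<^sub>R z) *\<^sub>R z)) + F x * r z)"
      unfolding e by simp
    thus ?thesis using i1 ig iF ir by simp
  qed
  have "(\<integral>z. (F (x + sqrt s *\<^sub>R z) - F x) * r z \<partial>std_gauss)
      = heat s F (x + a) - heat s F x - a \<bullet> heat_grad s F x"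
  proof -
    define q where "q z = a \<bullet> ((1 / sqrt s) *\<^sub>R (F (x + sqrt s *\<^sub>R z) *\<^sub>R z))" for z
    have "(\<integral>z. q z \<partial>std_gauss) = a \<bullet> (\<integral>z. (1 / sqrt s) *\<^sub>R (F (x + sqrt s *\<^sub>R z) *\<^sub>R z) \<partial>std_gauss)"
      unfolding q_def by (rule integral_inner_right) (intro integrable_scaleR_right log_lipschitz_integrable[OF K F])
    hence "(\<integral>z. q z \<partial>std_gauss) = a \<bullet> heat_grad s F x"
      unfolding heat_grad_def by (simp only: integral_scaleR_right)
    with ie iF ig ir show ?thesis
      unfolding e heat_shift[OF K F s(1)] \<alpha>_def[symmetric] q_def[symmetric]
      by (simp add: r0 heat_def)
  qed
  moreover have "norm (\<integral>z. (F (x + sqrt s *\<^sub>R z) - F x) * r z \<partial>std_gauss)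
     \<le> (3 * K * F x * ((norm a)\<^sup>2 / sqrt s) * exp 2) * ?m"
    by (rule integral_std_gauss_le[OF _ bound]) simp
  ultimately show ?thesis by (simp add: mult.assoc)
qed

lemma heat_dominates:
  assumes K: "K \<ge> 0"
  obtains C where "C > 0"
    "\<And>F s x. log_lipschitz K (F::'a::euclidean_space \<Rightarrow> real) \<Longrightarrow> 0 \<le> s \<Longrightarrow> s \<le> T \<Longrightarrow> F x \<le> C * heat s F x"
proof
  let ?m = "\<integral>z. exp (- (K * sqrt T) * norm z) \<partial>(std_gauss::'a measure)"
  have m: "?m > 0" by (rule integral_exp_norm_pos)
  thus "1 / ?m > 0" by simp
  fix F :: "'a \<Rightarrow> real" and s x
  assume "log_lipschitz K F" "0 \<le> s" "s \<le> T"
  from log_lipschitz_le_heat[OF K this, of x] m show "F x \<le> 1 / ?m * heat s F x"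
    by (simp add: field_simps)
qed

text \<open>For \<open>|a| > \<surd>s\<close> the remainder estimate needs no cancellation: the increment and the linear term
  are separately of relative order \<open>|a|\<close>, and \<open>|a| \<le> |a|\<^sup>2/\<surd>s\<close>. The constant is uniform over all
  functions that are log-Lipschitz with constant \<open>K\<close> and over \<open>s \<le> T\<close>.\<close>
lemma heat_first_order:
  assumes K: "K \<ge> 0"
  obtains C where "C > 0"
    "\<And>F s x. log_lipschitz K (F::'a::euclidean_space \<Rightarrow> real) \<Longrightarrow> 0 < s \<Longrightarrow> s \<le> T \<Longrightarrow>
       norm (heat_grad s F x) \<le> C * heat s F x"
    "\<And>F s x a. log_lipschitz K (F::'a::euclidean_space \<Rightarrow> real) \<Longrightarrow> 0 < s \<Longrightarrow> s \<le> T \<Longrightarrow>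
       \<bar>heat s F (x + a) - heat s F x - a \<bullet> heat_grad s F x\<bar>
         \<le> C * ((norm a)\<^sup>2 / sqrt s) * exp (K * norm a) * heat s F x"
proof -
  obtain C0 where C0: "C0 > 0"
    "\<And>F s x. log_lipschitz K (F::'a \<Rightarrow> real) \<Longrightarrow> 0 \<le> s \<Longrightarrow> s \<le> T \<Longrightarrow> F x \<le> C0 * heat s F x"
    using heat_dominates[OF K] by blast
  define m1 where "m1 = (\<integral>z. exp ((K * sqrt T + 1) * norm z) \<partial>(std_gauss::'a measure))"
  define m2 where "m2 = exp 2 * (\<integral>z. exp ((K * sqrt T + 3) * norm z) \<partial>(std_gauss::'a measure))"
  have m: "m1 > 0" "m2 > 0" by (simp_all add: m1_def m2_def integral_exp_norm_pos)
  define C1 where "C1 = 2 * K * C0 * m1"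
  define C2 where "C2 = 3 * K * C0 * m2"
  have C12: "C1 \<ge> 0" "C2 \<ge> 0" using K C0 m by (simp_all add: C1_def C2_def)
  define C where "C = C1 + C2 + K + 1"
  have C: "C > 0" using C12 K by (simp add: C_def)
  have g: "norm (heat_grad s F x) \<le> C1 * heat s F x"
    if F: "log_lipschitz K F" and s: "0 < s" "s \<le> T" for F :: "'a \<Rightarrow> real" and s x
  proof -
    have "norm (heat_grad s F x) \<le> 2 * K * F x * m1"
      unfolding m1_def by (rule heat_grad_bound[OF K F s])
    also have "\<dots> \<le> 2 * K * (C0 * heat s F x) * m1"
      using C0(2)[OF F, of s x] s K m by (intro mult_right_mono mult_left_mono) auto
    finally show ?thesis by (simp add: C1_def mult_ac)
  qed
  have r: "\<bar>heat s F (x + a) - heat s F x - a \<bullet> heat_grad s F x\<bar>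
         \<le> C * ((norm a)\<^sup>2 / sqrt s) * exp (K * norm a) * heat s F x"
    if F: "log_lipschitz K F" and s: "0 < s" "s \<le> T" for F :: "'a \<Rightarrow> real" and s x a
  proof -
    have G: "log_lipschitz K (heat s F)" using s by (intro log_lipschitz_heat[OF K F]) auto
    have pos: "heat s F x > 0" by (rule log_lipschitzD(2)[OF K G])
    have e1: "1 \<le> exp (K * norm a)" using K by simp
    define q where "q = (norm a)\<^sup>2 / sqrt s"
    have q: "q \<ge> 0" using s by (simp add: q_def)
    show ?thesis
    proof (cases "norm a \<le> sqrt s")
      case True
      have "\<bar>heat s F (x + a) - heat s F x - a \<bullet> heat_grad s F x\<bar> \<le> 3 * K * F x * q * m2"
        unfolding m2_def q_def by (rule heat_remainder_small[OF K F s True])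
      also have "\<dots> \<le> 3 * K * (C0 * heat s F x) * q * m2"
        using C0(2)[OF F, of s x] s K m q by (intro mult_right_mono mult_left_mono) auto
      also have "\<dots> = C2 * q * 1 * heat s F x" by (simp add: C2_def)
      also have "\<dots> \<le> C * q * exp (K * norm a) * heat s F x"
        using C12 K pos e1 q C by (intro mult_mono) (auto simp: C_def)
      finally show ?thesis by (simp add: q_def)
    next
      case False
      hence aq: "norm a \<le> q"
        using s mult_left_mono[of "sqrt s" "norm a" "norm a"] by (simp add: q_def field_simps power2_eq_square)
      have "\<bar>a \<bullet> heat_grad s F x\<bar> \<le> norm a * (C1 * heat s F x)"
        by (rule order.trans[OF Cauchy_Schwarz_ineq2]) (intro mult_left_mono g[OF F s] norm_ge_zero)
      also have "\<dots> \<le> norm a * (C1 * heat s F x) * exp (K * norm a)"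
        using e1 C12 pos mult_left_mono[of 1 "exp (K * norm a)" "norm a * (C1 * heat s F x)"] by simp
      finally have "\<bar>heat s F (x + a) - heat s F x - a \<bullet> heat_grad s F x\<bar>
          \<le> (K + C1) * norm a * exp (K * norm a) * heat s F x"
        using log_lipschitz_diff[OF K G, of x a] by (simp add: algebra_simps)
      also have "\<dots> \<le> C * q * exp (K * norm a) * heat s F x"
        using C12 K pos aq q by (intro mult_right_mono mult_mono) (auto simp: C_def)
      finally show ?thesis by (simp add: q_def)
    qed
  qed
  show thesis
  proof (rule that[OF C])
    fix F :: "'a \<Rightarrow> real" and s x
    assume F: "log_lipschitz K F" and s: "0 < s" "s \<le> T"
    have "heat s F x > 0" using s by (intro log_lipschitzD(2)[OF K log_lipschitz_heat[OF K F]]) auto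
    hence "C1 * heat s F x \<le> C * heat s F x" using C12 K by (intro mult_right_mono) (auto simp: C_def)
    with g[OF F s, of x] show "norm (heat_grad s F x) \<le> C * heat s F x" by linarith
  qed (rule r)
qed

lemma gderiv_heat:
  assumes K: "K \<ge> 0" and F: "log_lipschitz K (F::'a::euclidean_space \<Rightarrow> real)" and s: "s > 0"
  shows "GDERIV (heat s F) x :> heat_grad s F x"
proof -
  obtain C where C: "C > 0"
    "\<And>F s' x a. log_lipschitz K (F::'a \<Rightarrow> real) \<Longrightarrow> 0 < s' \<Longrightarrow> s' \<le> s \<Longrightarrow>
       \<bar>heat s' F (x + a) - heat s' F x - a \<bullet> heat_grad s' F x\<bar>
         \<le> C * ((norm a)\<^sup>2 / sqrt s') * exp (K * norm a) * heat s' F x"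
    by (rule heat_first_order[OF K, of s, where 'a='a]) blast
  have "((\<lambda>a. norm (heat s F (x + a) - heat s F x - a \<bullet> heat_grad s F x) / norm a) \<longlongrightarrow> 0) (at 0)"
  proof (rule Lim_null_comparison)
    show "\<forall>\<^sub>F a in at 0. norm (norm (heat s F (x + a) - heat s F x - a \<bullet> heat_grad s F x) / norm a)
        \<le> C / sqrt s * heat s F x * (norm a * exp (K * norm a))"
      unfolding eventually_at_filter
    proof (rule always_eventually, intro allI impI)
      fix a :: 'a assume "a \<noteq> 0"
      thus "norm (norm (heat s F (x + a) - heat s F x - a \<bullet> heat_grad s F x) / norm a)
        \<le> C / sqrt s * heat s F x * (norm a * exp (K * norm a))"
        using C(2)[OF F s order.refl, of x a] s by (simp add: field_simps power2_eq_square)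
    qed
    have "((\<lambda>a::'a. C / sqrt s * heat s F x * (norm a * exp (K * norm a))) \<longlongrightarrow>
        C / sqrt s * heat s F x * (norm (0::'a) * exp (K * norm (0::'a)))) (at 0)"
      by (intro tendsto_intros)
    thus "((\<lambda>a::'a. C / sqrt s * heat s F x * (norm a * exp (K * norm a))) \<longlongrightarrow> 0) (at 0)" by simp
  qed
  thus ?thesis
    unfolding gderiv_def has_derivative_at
    by (simp add: bounded_linear_inner_left)
qed

lemma grad_eqI:
  assumes "GDERIV f y :> D"
  shows "grad f y = D"
  unfolding grad_def
proof (rule the_equality)
  fix D' assume "GDERIV f y :> D'"
  with assms have "(\<lambda>h. h \<bullet> D') = (\<lambda>h. h \<bullet> D)"
    unfolding gderiv_def by (intro has_derivative_unique)
  thus "D' = D" by (metis vector_eq_rdot inner_commute)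
qed (rule assms)

text \<open>Since \<open>heat (s + h) F\<close> averages \<open>heat s F\<close> over a Gaussian of variance \<open>h\<close>, the linear term of
  the space expansion integrates to zero and the quadratic one to order \<open>h/\<surd>s\<close>. When \<open>s < h\<close>, in
  particular at \<open>s = 0\<close>, the Lipschitz bound gives \<open>\<surd>h = h/\<surd>h\<close> instead.\<close>
lemma heat_time_increment:
  assumes K: "K \<ge> 0"
  obtains C where "C > 0"
    "\<And>F s h x. log_lipschitz K (F::'a::euclidean_space \<Rightarrow> real) \<Longrightarrow> 0 \<le> s \<Longrightarrow> 0 < h \<Longrightarrow> s + h \<le> T \<Longrightarrow>
       \<bar>heat (s + h) F x - heat s F x\<bar> \<le> C * (h / sqrt (max s h)) * heat s F x"
proof -
  obtain C1 where C1: "C1 > 0"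
    "\<And>F s x a. log_lipschitz K (F::'a \<Rightarrow> real) \<Longrightarrow> 0 < s \<Longrightarrow> s \<le> T \<Longrightarrow>
       \<bar>heat s F (x + a) - heat s F x - a \<bullet> heat_grad s F x\<bar>
         \<le> C1 * ((norm a)\<^sup>2 / sqrt s) * exp (K * norm a) * heat s F x"
    by (rule heat_first_order[OF K, of T, where 'a='a]) blast
  define m where "m = (\<integral>z. exp ((K * sqrt T + 1) * norm z) \<partial>(std_gauss::'a measure))"
  have m: "m > 0" by (simp add: m_def integral_exp_norm_pos)
  define C where "C = (2 * C1 + K) * m"
  have C: "C > 0" using C1 K m by (simp add: C_def)
  show thesis
  proof (rule that[OF C])
    fix F :: "'a \<Rightarrow> real" and s h x
    assume F: "log_lipschitz K F" and s: "0 \<le> s" and h: "0 < h" and T: "s + h \<le> T"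
    define G where "G = heat s F"
    have G: "log_lipschitz K G" unfolding G_def by (rule log_lipschitz_heat[OF K F s])
    note [measurable] = log_lipschitzD(1)[OF K G]
    have pos: "G x > 0" by (rule log_lipschitzD(2)[OF K G])
    have eq: "heat (s + h) F x = heat h G x" unfolding G_def using s h by (intro heat_heat[OF K F, symmetric]) auto
    have mono: "exp (K * (sqrt h * norm z)) \<le> exp (K * (sqrt T * norm z))" for z :: 'a
      using K h s T by (auto intro!: mult_left_mono mult_right_mono)
    show "\<bar>heat (s + h) F x - heat s F x\<bar> \<le> C * (h / sqrt (max s h)) * heat s F x"
    proof (cases "h \<le> s")
      case True
      hence s': "0 < s" "s \<le> T" using h T by auto
      define D where "D = heat_grad s F x"
      have bound: "norm (G (x + sqrt h *\<^sub>R z) - G x - (sqrt h *\<^sub>R z) \<bullet> D)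
         \<le> (2 * C1 * (h / sqrt s) * G x) * exp ((K * sqrt T + 1) * norm z)" for z
      proof -
        have "norm (G (x + sqrt h *\<^sub>R z) - G x - (sqrt h *\<^sub>R z) \<bullet> D)
          \<le> C1 * ((norm (sqrt h *\<^sub>R z))\<^sup>2 / sqrt s) * exp (K * norm (sqrt h *\<^sub>R z)) * G x"
          using C1(2)[OF F s', of x "sqrt h *\<^sub>R z"] by (simp add: G_def D_def)
        also have "\<dots> = C1 * (h / sqrt s) * G x * ((norm z)\<^sup>2 * exp (K * (sqrt h * norm z)))"
          using h by (simp add: power_mult_distrib)
        also have "\<dots> \<le> C1 * (h / sqrt s) * G x * ((2 * exp (norm z)) * exp (K * (sqrt T * norm z)))"
          using C1 h s' pos by (intro mult_left_mono mult_mono mono square_le_exp) auto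
        also have "\<dots> = (2 * C1 * (h / sqrt s) * G x) * exp ((K * sqrt T + 1) * norm z)"
          by (simp add: exp_add algebra_simps)
        finally show ?thesis .
      qed
      have i: "integrable std_gauss (\<lambda>z. (sqrt h *\<^sub>R z) \<bullet> D)"
        using integral_std_gauss_odd(1)[of "sqrt h *\<^sub>R D"] by (simp add: inner_commute)
      have i0: "(\<integral>z. (sqrt h *\<^sub>R z) \<bullet> D \<partial>std_gauss) = 0"
        using integral_std_gauss_odd(2)[of "sqrt h *\<^sub>R D"] by (simp add: inner_commute)
      have "heat h G x - G x = (\<integral>z. G (x + sqrt h *\<^sub>R z) - G x - (sqrt h *\<^sub>R z) \<bullet> D \<partial>std_gauss)"
        using log_lipschitz_integrable(1)[OF K G] i i0 std_gauss.prob_space[where 'a='a]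
        by (simp add: heat_def)
      also have "norm \<dots> \<le> (2 * C1 * (h / sqrt s) * G x) * m"
        unfolding m_def by (rule integral_std_gauss_le[OF _ bound]) simp
      also have "\<dots> \<le> C * (h / sqrt (max s h)) * G x"
        using True K h s' pos m by (simp add: C_def max_absorb1 algebra_simps)
      finally show ?thesis unfolding eq by (simp add: G_def)
    next
      case False
      have bound: "norm (G (x + sqrt h *\<^sub>R z) - G x)
         \<le> (K * sqrt h * G x) * exp ((K * sqrt T + 1) * norm z)" for z
      proof -
        have "norm (G (x + sqrt h *\<^sub>R z) - G x) \<le> G x * (K * (sqrt h * norm z)) * exp (K * (sqrt h * norm z))"
          using log_lipschitz_diff[OF K G, of x "sqrt h *\<^sub>R z"] h by simp
        also have "\<dots> = (K * sqrt h * G x) * (norm z * exp (K * (sqrt h * norm z)))" by simp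
        also have "\<dots> \<le> (K * sqrt h * G x) * (exp (norm z) * exp (K * (sqrt T * norm z)))"
          using K h pos by (intro mult_left_mono mult_mono mono le_exp_self) auto
        also have "\<dots> = (K * sqrt h * G x) * exp ((K * sqrt T + 1) * norm z)"
          by (simp add: exp_add algebra_simps)
        finally show ?thesis .
      qed
      have "heat h G x - G x = (\<integral>z. G (x + sqrt h *\<^sub>R z) - G x \<partial>std_gauss)"
        using log_lipschitz_integrable(1)[OF K G] std_gauss.prob_space[where 'a='a]
        by (simp add: heat_def)
      also have "norm \<dots> \<le> (K * sqrt h * G x) * m"
        unfolding m_def by (rule integral_std_gauss_le[OF _ bound]) simp
      also have "\<dots> = K * m * (h / sqrt (max s h)) * G x"
        using False h by (simp add: max_absorb2 real_div_sqrt)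
      also have "\<dots> \<le> C * (h / sqrt (max s h)) * G x"
        using C1 K h s pos m by (intro mult_right_mono) (auto simp: C_def)
      finally show ?thesis unfolding eq by (simp add: G_def)
    qed
  qed
qed

section \<open>The cost of one Euler step\<close>

definition heat_drift :: "real \<Rightarrow> ('a::euclidean_space \<Rightarrow> real) \<Rightarrow> 'a \<Rightarrow> 'a" where
  "heat_drift s F x = heat_grad s F x /\<^sub>R heat s F x"

lemma heat_drift_measurable:
  assumes "K \<ge> 0" "log_lipschitz K F"
  shows "heat_drift s F \<in> borel_measurable borel"
proof -
  note [measurable] = heat_measurable[OF assms]
  show ?thesis unfolding heat_drift_def[abs_def] by measurable
qed

text \<open>The Doob transform of Brownian motion moves from \<open>x\<close>, in time \<open>h\<close> with \<open>s\<close> remaining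
  afterwards, with density \<open>heat s F y / heat (s + h) F x\<close> relative to the Gaussian law of
  \<open>x + \<surd>h w\<close>; the Euler step has density \<open>exp (\<alpha> \<bullet> w - |\<alpha>|\<^sup>2/2)\<close> relative to the same law. Hence
  the integral below is \<open>\<integral> (dP/dQ)\<^sup>2 dQ\<close>, that is, one plus the chi-square divergence of the
  transition kernel \<open>P\<close> of the transform from the Euler kernel \<open>Q\<close>.\<close>
definition euler_ratio_moment :: "real \<Rightarrow> real \<Rightarrow> ('a::euclidean_space \<Rightarrow> real) \<Rightarrow> 'a \<Rightarrow> ennreal" where
  "euler_ratio_moment s h F x = (let \<alpha> = sqrt h *\<^sub>R heat_drift (s + h) F x in
     \<integral>\<^sup>+w. ennreal ((heat s F (x + sqrt h *\<^sub>R w) / heat (s + h) F x)\<^sup>2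
       * exp (- (\<alpha> \<bullet> w - (norm \<alpha>)\<^sup>2 / 2))) \<partial>std_gauss)"

text \<open>With \<open>g\<close> and \<open>e\<close> the two densities above, \<open>g\<^sup>2/e = 2 g - e + (g - e)\<^sup>2/e\<close>, and both
  densities have integral 1, so only \<open>(g - e)\<^sup>2/e\<close> contributes. The drift is chosen so that
  \<open>1 + \<alpha> \<bullet> w\<close> is the common first-order part of \<open>g\<close> and \<open>e\<close>. What remains in \<open>g\<close> is a time
  increment of the heat flow at the new point plus a space remainder of the earlier, smoother function
  \<open>heat (s + h) F\<close>; expanding that one rather than \<open>heat s F\<close> keeps the bound meaningful at
  \<open>s = 0\<close>, the last step. Altogether \<open>g - e\<close> is of order \<open>h / \<surd>(max s h)\<close>, and the bound follows by
  squaring.\<close>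
lemma chi_square_one_step:
  assumes K: "K \<ge> 0" and T: "T > 0"
  obtains C where "C > 0"
    "\<And>F s h x. log_lipschitz K (F::'a::euclidean_space \<Rightarrow> real) \<Longrightarrow> 0 \<le> s \<Longrightarrow> 0 < h \<Longrightarrow> s + h \<le> T \<Longrightarrow>
       euler_ratio_moment s h F x \<le> ennreal (1 + C * (h\<^sup>2 / max s h))"
proof -
  obtain C0 where C0: "C0 > 0"
    "\<And>F s x. log_lipschitz K (F::'a \<Rightarrow> real) \<Longrightarrow> 0 \<le> s \<Longrightarrow> s \<le> T \<Longrightarrow> F x \<le> C0 * heat s F x"
    using heat_dominates[OF K] by blast
  obtain C1 where C1: "C1 > 0"
    "\<And>F s x. log_lipschitz K (F::'a \<Rightarrow> real) \<Longrightarrow> 0 < s \<Longrightarrow> s \<le> T \<Longrightarrow>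
       norm (heat_grad s F x) \<le> C1 * heat s F x"
    "\<And>F s x a. log_lipschitz K (F::'a \<Rightarrow> real) \<Longrightarrow> 0 < s \<Longrightarrow> s \<le> T \<Longrightarrow>
       \<bar>heat s F (x + a) - heat s F x - a \<bullet> heat_grad s F x\<bar>
         \<le> C1 * ((norm a)\<^sup>2 / sqrt s) * exp (K * norm a) * heat s F x"
    by (rule heat_first_order[OF K, of T, where 'a='a]) blast
  obtain C2 where C2: "C2 > 0"
    "\<And>F s h x. log_lipschitz K (F::'a \<Rightarrow> real) \<Longrightarrow> 0 \<le> s \<Longrightarrow> 0 < h \<Longrightarrow> s + h \<le> T \<Longrightarrow>
       \<bar>heat (s + h) F x - heat s F x\<bar> \<le> C2 * (h / sqrt (max s h)) * heat s F x"
    by (rule heat_time_increment[OF K, of T, where 'a='a]) blast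
  define R where "R = sqrt T * C1"
  define c where "c = K * sqrt T + R + 2"
  define C3 where "C3 = C2 * C0 + 2 * C1 + 3 * C1\<^sup>2 * sqrt T * exp ((R + 1) * R)"
  define m where "m = (\<integral>z. exp ((2 * c + R) * norm z) \<partial>(std_gauss::'a measure))"
  define C where "C = C3\<^sup>2 * exp (R\<^sup>2 / 2) * m"
  have R: "R \<ge> 0" using C1 T by (simp add: R_def)
  have C3: "C3 > 0" using C0 C1 C2 T by (auto simp: C3_def intro!: add_pos_nonneg)
  have m: "m > 0" by (simp add: m_def integral_exp_norm_pos)
  have C: "C > 0" using C3 m by (simp add: C_def)
  show thesis
  proof (rule that[OF C])
    fix F :: "'a \<Rightarrow> real" and s h x
    assume F: "log_lipschitz K F" and s: "0 \<le> s" and h: "0 < h" and sh: "s + h \<le> T"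
    define \<alpha> where "\<alpha> = sqrt h *\<^sub>R heat_drift (s + h) F x"
    define u where "u = heat (s + h) F"
    define G where "G = heat s F"
    have G: "log_lipschitz K G" unfolding G_def by (rule log_lipschitz_heat[OF K F s])
    have u: "log_lipschitz K u" unfolding u_def using s h by (intro log_lipschitz_heat[OF K F]) auto
    note [measurable] = log_lipschitzD(1)[OF K G] log_lipschitzD(1)[OF K u]
    have upos: "u y > 0" and Gpos: "G y > 0" for y
      using log_lipschitzD(2)[OF K u] log_lipschitzD(2)[OF K G] by auto
    have uG: "u = heat h G" unfolding u_def G_def
      using s h by (intro ext heat_heat[OF K F, symmetric]) auto
    define \<delta> where "\<delta> = h / sqrt (max s h)"
    have \<delta>: "\<delta> > 0" using h by (simp add: \<delta>_def)
    have h\<delta>: "h \<le> sqrt T * \<delta>"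
    proof -
      have "sqrt (max s h) \<le> sqrt T" using s h sh by simp
      hence "h * sqrt (max s h) \<le> h * sqrt T" using h by (intro mult_left_mono) auto
      thus ?thesis using h by (simp add: \<delta>_def field_simps)
    qed
    have \<delta>2: "\<delta>\<^sup>2 = h\<^sup>2 / max s h" using h by (simp add: \<delta>_def power_divide)
    have n\<alpha>: "norm \<alpha> \<le> sqrt h * C1"
    proof -
      have "norm (heat_grad (s + h) F x) \<le> C1 * u x"
        using C1(2)[OF F, of "s + h" x] s h sh by (simp add: u_def)
      thus ?thesis using h upos[of x] unfolding \<alpha>_def heat_drift_def u_def[symmetric] by (simp add: field_simps)
    qed
    also have "\<dots> \<le> R" using h s sh C1 by (auto simp: R_def intro!: mult_right_mono)
    finally have n\<alpha>R: "norm \<alpha> \<le> R" .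
    have n\<alpha>2: "(norm \<alpha>)\<^sup>2 \<le> h * C1\<^sup>2"
      using power_mono[OF n\<alpha>, of 2] h by (simp add: power_mult_distrib)
    define g where "g w = G (x + sqrt h *\<^sub>R w) / u x" for w
    define e where "e w = exp (\<alpha> \<bullet> w - (norm \<alpha>)\<^sup>2 / 2)" for w
    have [measurable]: "g \<in> borel_measurable borel" "e \<in> borel_measurable borel"
      unfolding g_def e_def by measurable
    have epos: "e w > 0" for w by (simp add: e_def)
    have sqrtT: "exp (K * (sqrt h * norm w)) \<le> exp (K * sqrt T * norm w)" for w :: 'a
      using K h s sh by (auto intro!: mult_left_mono mult_right_mono simp: mult.assoc)

    have g1: "\<bar>g w - 1 - \<alpha> \<bullet> w\<bar> \<le> (C2 * C0 + 2 * C1) * \<delta> * exp (c * norm w)" for w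
    proof -
      define y where "y = x + sqrt h *\<^sub>R w"
      have Ey: "exp (K * sqrt T * norm w) \<le> exp (c * norm w)"
        using R by (auto simp: c_def intro!: mult_right_mono)
      have Ey2: "exp (norm w) * exp (K * sqrt T * norm w) \<le> exp (c * norm w)"
        using R by (auto simp: c_def exp_add[symmetric] distrib_right)
      \<comment> \<open>Time increment at the new point, brought back to \<open>x\<close> by domination and the Lipschitz bound.\<close>
      have "\<bar>G y - u y\<bar> \<le> C2 * \<delta> * G y"
        using C2(2)[OF F s h sh, of y] by (simp add: u_def G_def \<delta>_def abs_minus_commute)
      also have "\<dots> \<le> C2 * \<delta> * (C0 * (u x * exp (c * norm w)))"
      proof -
        have "G y \<le> C0 * u y" using C0(2)[OF G, of h y] h s sh by (simp add: uG)
        also have "u y \<le> u x * exp (K * (sqrt h * norm w))"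
          using log_lipschitzD(3)[OF K u, of x "sqrt h *\<^sub>R w"] h by (simp add: y_def)
        also have "\<dots> \<le> u x * exp (c * norm w)"
          using upos[of x] Ey sqrtT[of w] by (intro mult_left_mono) auto
        finally have "G y \<le> C0 * (u x * exp (c * norm w))" using C0 by simp
        thus ?thesis using C2 \<delta> by (intro mult_left_mono) auto
      qed
      finally have 1: "\<bar>G y - u y\<bar> \<le> (C2 * C0 * \<delta> * exp (c * norm w)) * u x" by (simp add: mult_ac)
      \<comment> \<open>Space remainder of \<open>heat (s + h) F\<close>, of order \<open>h / \<surd>(s + h)\<close>.\<close>
      have "\<bar>u y - u x - (sqrt h *\<^sub>R w) \<bullet> heat_grad (s + h) F x\<bar>
          \<le> C1 * ((norm (sqrt h *\<^sub>R w))\<^sup>2 / sqrt (s + h)) * exp (K * norm (sqrt h *\<^sub>R w)) * u x"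
        unfolding u_def y_def using s h sh by (intro C1(3)[OF F]) auto
      also have "\<dots> = (C1 * (h / sqrt (s + h)) * ((norm w)\<^sup>2 * exp (K * (sqrt h * norm w)))) * u x"
        using h by (simp add: power_mult_distrib)
      also have "\<dots> \<le> (C1 * \<delta> * (2 * exp (norm w) * exp (K * sqrt T * norm w))) * u x"
        using C1 h s upos[of x] \<delta> unfolding \<delta>_def
        by (intro mult_right_mono mult_mono square_le_exp sqrtT divide_left_mono) auto
      also have "\<dots> \<le> (2 * C1 * \<delta> * exp (c * norm w)) * u x"
        using mult_left_mono[OF Ey2, of "C1 * \<delta>"] C1 \<delta> upos[of x]
        by (intro mult_right_mono) (auto simp: mult_ac)
      finally have 2: "\<bar>u y - u x - (sqrt h *\<^sub>R w) \<bullet> heat_grad (s + h) F x\<bar>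
          \<le> (2 * C1 * \<delta> * exp (c * norm w)) * u x" .
      have "\<alpha> \<bullet> w * u x = (sqrt h *\<^sub>R w) \<bullet> heat_grad (s + h) F x"
        using upos[of x] unfolding \<alpha>_def heat_drift_def u_def[symmetric] by (simp add: inner_commute)
      moreover have "g w * u x = G y" using upos[of x] by (simp add: g_def y_def)
      ultimately have "(g w - 1 - \<alpha> \<bullet> w) * u x
          = (G y - u y) + (u y - u x - (sqrt h *\<^sub>R w) \<bullet> heat_grad (s + h) F x)"
        by (simp add: algebra_simps)
      hence "\<bar>g w - 1 - \<alpha> \<bullet> w\<bar> * u x
          = \<bar>(G y - u y) + (u y - u x - (sqrt h *\<^sub>R w) \<bullet> heat_grad (s + h) F x)\<bar>"
        using upos[of x] by (metis abs_mult abs_of_pos)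
      also have "\<dots> \<le> ((C2 * C0 + 2 * C1) * \<delta> * exp (c * norm w)) * u x"
        using 1 2 unfolding distrib_right by linarith
      finally show ?thesis using upos[of x] by simp
    qed

    have e1: "\<bar>e w - 1 - \<alpha> \<bullet> w\<bar> \<le> (3 * C1\<^sup>2 * sqrt T * exp ((R + 1) * R)) * \<delta> * exp (c * norm w)" for w
    proof -
      have "\<bar>e w - 1 - \<alpha> \<bullet> w\<bar> \<le> 3 * (norm \<alpha>)\<^sup>2 * exp ((R + 1) * (norm w + R))"
        unfolding e_def by (rule exp_martingale_remainder[OF n\<alpha>R])
      also have "\<dots> = 3 * (norm \<alpha>)\<^sup>2 * exp ((R + 1) * norm w) * exp ((R + 1) * R)"
        by (simp add: exp_add distrib_left)
      also have "\<dots> \<le> 3 * (sqrt T * \<delta> * C1\<^sup>2) * exp (c * norm w) * exp ((R + 1) * R)"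
      proof -
        have "(norm \<alpha>)\<^sup>2 \<le> sqrt T * \<delta> * C1\<^sup>2"
          using n\<alpha>2 mult_right_mono[OF h\<delta>, of "C1\<^sup>2"] by simp
        moreover have "(R + 1) * norm w \<le> c * norm w"
          using K T by (intro mult_right_mono) (auto simp: c_def)
        ultimately show ?thesis using T \<delta> by (intro mult_right_mono mult_mono mult_left_mono) auto
      qed
      finally show ?thesis by (simp add: mult_ac)
    qed

    have ge: "\<bar>g w - e w\<bar> \<le> C3 * \<delta> * exp (c * norm w)" for w
    proof -
      have "g w - e w = (g w - 1 - \<alpha> \<bullet> w) - (e w - 1 - \<alpha> \<bullet> w)" by simp
      hence "\<bar>g w - e w\<bar> \<le> \<bar>g w - 1 - \<alpha> \<bullet> w\<bar> + \<bar>e w - 1 - \<alpha> \<bullet> w\<bar>" by linarith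
      also have "\<dots> \<le> C3 * \<delta> * exp (c * norm w)"
        using g1[of w] e1[of w] unfolding C3_def distrib_right by linarith
      finally show ?thesis .
    qed
    have bound: "norm ((g w - e w)\<^sup>2 / e w) \<le> (C3\<^sup>2 * \<delta>\<^sup>2 * exp (R\<^sup>2 / 2)) * exp ((2 * c + R) * norm w)" for w
    proof -
      have 1: "(g w - e w)\<^sup>2 \<le> (C3 * \<delta> * exp (c * norm w))\<^sup>2"
        using power_mono[OF ge[of w], of 2] by simp
      have 2: "1 / e w \<le> exp (R * norm w + R\<^sup>2 / 2)"
      proof -
        have "\<bar>\<alpha> \<bullet> w\<bar> \<le> R * norm w"
          by (rule order.trans[OF Cauchy_Schwarz_ineq2]) (intro mult_right_mono n\<alpha>R norm_ge_zero)
        moreover have "(norm \<alpha>)\<^sup>2 \<le> R\<^sup>2" using n\<alpha>R by (simp add: power_mono)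
        ultimately have "- (\<alpha> \<bullet> w - (norm \<alpha>)\<^sup>2 / 2) \<le> R * norm w + R\<^sup>2 / 2" by linarith
        thus ?thesis by (simp add: e_def exp_minus[symmetric] inverse_eq_divide[symmetric] del: minus_diff_eq)
      qed
      have "norm ((g w - e w)\<^sup>2 / e w) = (g w - e w)\<^sup>2 * (1 / e w)" using epos[of w] by simp
      also have "\<dots> \<le> (C3 * \<delta> * exp (c * norm w))\<^sup>2 * exp (R * norm w + R\<^sup>2 / 2)"
        using 1 2 epos[of w] by (intro mult_mono) auto
      also have "\<dots> = (C3\<^sup>2 * \<delta>\<^sup>2 * exp (R\<^sup>2 / 2)) * exp ((2 * c + R) * norm w)"
      proof -
        have "(exp (c * norm w))\<^sup>2 * exp (R * norm w + R\<^sup>2 / 2) = exp (R\<^sup>2 / 2) * exp ((2 * c + R) * norm w)"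
          by (simp add: exp_add[symmetric] exp_double[symmetric] algebra_simps)
        thus ?thesis by (simp add: power_mult_distrib mult_ac)
      qed
      finally show ?thesis .
    qed
    have id: "integrable std_gauss (\<lambda>w. (g w - e w)\<^sup>2 / e w)"
      by (rule integrable_std_gauss_bounded[OF _ bound]) simp
    have ie: "integrable std_gauss e" and e0: "(\<integral>w. e w \<partial>std_gauss) = 1"
      unfolding e_def by (rule integral_exp_martingale)+
    have ig: "integrable std_gauss g" and g0: "(\<integral>w. g w \<partial>std_gauss) = 1"
    proof -
      show "integrable std_gauss g"
        unfolding g_def by (intro integrable_divide log_lipschitz_integrable[OF K G])
      show "(\<integral>w. g w \<partial>std_gauss) = 1"
        unfolding g_def using upos[of x] by (simp add: uG heat_def)
    qed
    have eq: "(g w)\<^sup>2 * exp (- (\<alpha> \<bullet> w - (norm \<alpha>)\<^sup>2 / 2)) = 2 * g w - e w + (g w - e w)\<^sup>2 / e w" for w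
    proof -
      have "exp (- (\<alpha> \<bullet> w - (norm \<alpha>)\<^sup>2 / 2)) = 1 / e w"
        unfolding e_def exp_minus by (simp add: inverse_eq_divide)
      thus ?thesis using epos[of w] by (simp add: field_simps power2_eq_square)
    qed
    have i: "integrable std_gauss (\<lambda>w. 2 * g w - e w + (g w - e w)\<^sup>2 / e w)"
      using id ie ig by simp
    have "(\<integral>\<^sup>+w. ennreal ((g w)\<^sup>2 * exp (- (\<alpha> \<bullet> w - (norm \<alpha>)\<^sup>2 / 2))) \<partial>std_gauss)
        = ennreal (\<integral>w. 2 * g w - e w + (g w - e w)\<^sup>2 / e w \<partial>std_gauss)"
      unfolding eq
      by (intro nn_integral_eq_integral i AE_I2) (simp flip: eq)
    also have "(\<integral>w. 2 * g w - e w + (g w - e w)\<^sup>2 / e w \<partial>std_gauss)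
        = 1 + (\<integral>w. (g w - e w)\<^sup>2 / e w \<partial>std_gauss)"
      using id ie ig e0 g0 by simp
    also have "(\<integral>w. (g w - e w)\<^sup>2 / e w \<partial>std_gauss) \<le> (C3\<^sup>2 * \<delta>\<^sup>2 * exp (R\<^sup>2 / 2)) * m"
      using integral_std_gauss_le[OF _ bound] unfolding m_def by simp
    also have "\<dots> = C * (h\<^sup>2 / max s h)" by (simp add: C_def \<delta>2)
    finally show "euler_ratio_moment s h F x \<le> ennreal (1 + C * (h\<^sup>2 / max s h))"
      unfolding euler_ratio_moment_def Let_def g_def G_def u_def \<alpha>_def by (simp add: ennreal_leI)
  qed
qed

text \<open>The conditional expectation of \<open>f\<close> at the final time for the Doob transform started at \<open>x\<close> with
  time \<open>s\<close> left. It takes values in the extended nonnegative reals, so that it is defined and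
  measurable for every measurable \<open>f \<ge> 0\<close>.\<close>
definition doob :: "real \<Rightarrow> ('a::euclidean_space \<Rightarrow> real) \<Rightarrow> ('a \<Rightarrow> ennreal) \<Rightarrow> 'a \<Rightarrow> ennreal" where
  "doob s F f x = (\<integral>\<^sup>+z. f (x + sqrt s *\<^sub>R z) * ennreal (F (x + sqrt s *\<^sub>R z)) \<partial>std_gauss) / ennreal (heat s F x)"

lemma doob_measurable [measurable]:
  assumes [measurable]: "F \<in> borel_measurable borel" "f \<in> borel_measurable borel"
  shows "doob s F f \<in> borel_measurable borel"
  unfolding doob_def heat_def by measurable

lemma doob_zero:
  assumes "0 < F x"
  shows "doob 0 F f x = f x"
  using assms by (simp add: doob_def ennreal_mult_divide_eq)

lemma doob_chapman_kolmogorov: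
  assumes K: "K \<ge> 0" and F: "log_lipschitz K F" and s: "s \<ge> 0" and h: "h \<ge> 0"
    and [measurable]: "f \<in> borel_measurable borel"
  shows "doob (s + h) F f x
       = (\<integral>\<^sup>+w. ennreal (heat s F (x + sqrt h *\<^sub>R w) / heat (s + h) F x) * doob s F f (x + sqrt h *\<^sub>R w) \<partial>std_gauss)"
proof -
  note [measurable] = log_lipschitzD(1)[OF K F]
  have G: "heat s F y > 0" for y by (rule log_lipschitzD(2)[OF K log_lipschitz_heat[OF K F s]])
  have u: "heat (s + h) F y > 0" for y using s h by (intro log_lipschitzD(2)[OF K log_lipschitz_heat[OF K F]]) auto
  define N where "N y = (\<integral>\<^sup>+z. f (y + sqrt s *\<^sub>R z) * ennreal (F (y + sqrt s *\<^sub>R z)) \<partial>std_gauss)" for y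
  have [measurable]: "N \<in> borel_measurable borel" unfolding N_def by measurable
  have "ennreal (heat s F y / heat (s + h) F x) * doob s F f y = N y / ennreal (heat (s + h) F x)" for y
  proof -
    have "ennreal (heat s F y / heat (s + h) F x) * doob s F f y
       = (ennreal (heat s F y) / ennreal (heat s F y)) * (N y / ennreal (heat (s + h) F x))"
      unfolding doob_def N_def using G[of y] u[of x]
      by (simp add: divide_ennreal[symmetric] divide_ennreal_def mult_ac)
    thus ?thesis using G[of y] by (simp add: divide_ennreal one_ennreal_def[symmetric] del: ennreal_1 ennreal_eq_1)
  qed
  hence "(\<integral>\<^sup>+w. ennreal (heat s F (x + sqrt h *\<^sub>R w) / heat (s + h) F x) * doob s F f (x + sqrt h *\<^sub>R w) \<partial>std_gauss)
      = (\<integral>\<^sup>+w. N (x + sqrt h *\<^sub>R w) \<partial>std_gauss) / ennreal (heat (s + h) F x)"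
    by (simp add: nn_integral_divide)
  also have "(\<integral>\<^sup>+w. N (x + sqrt h *\<^sub>R w) \<partial>std_gauss)
      = (\<integral>\<^sup>+z. f (x + sqrt (s + h) *\<^sub>R z) * ennreal (F (x + sqrt (s + h) *\<^sub>R z)) \<partial>std_gauss)"
    unfolding N_def by (rule nn_integral_std_gauss_semigroup[of "\<lambda>y. f y * ennreal (F y)"]) (use s h in auto)
  finally show ?thesis by (simp add: doob_def)
qed

text \<open>One step of the backward induction. Splitting \<open>g V = (g exp (- l/2)) (V exp (l/2))\<close>, with
  \<open>e = exp l\<close> the density of the Euler step relative to centred noise, Cauchy-Schwarz yields the
  chi-square factor and the integral of \<open>V\<^sup>2 e\<close>, which the shift formula turns into the expectation of
  \<open>V\<^sup>2\<close> after an Euler step.\<close>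
lemma doob_square_le:
  assumes K: "K \<ge> 0" and F: "log_lipschitz K F" and s: "s \<ge> 0" and h: "h > 0"
    and [measurable]: "f \<in> borel_measurable borel"
  shows "(doob (s + h) F f x)\<^sup>2 \<le> euler_ratio_moment s h F x
      * (\<integral>\<^sup>+z. (doob s F f (x + h *\<^sub>R heat_drift (s + h) F x + sqrt h *\<^sub>R z))\<^sup>2 \<partial>std_gauss)"
proof -
  note [measurable] = log_lipschitzD(1)[OF K F] heat_measurable[OF K F]
  define V where "V = doob s F f"
  have [measurable]: "V \<in> borel_measurable borel" unfolding V_def by measurable
  have u: "heat (s + h) F y > 0" for y using s h by (intro log_lipschitzD(2)[OF K log_lipschitz_heat[OF K F]]) auto
  have G: "heat s F y > 0" for y by (rule log_lipschitzD(2)[OF K log_lipschitz_heat[OF K F s]])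
  define b where "b = heat_drift (s + h) F x"
  define \<alpha> where "\<alpha> = sqrt h *\<^sub>R b"
  define g where "g w = heat s F (x + sqrt h *\<^sub>R w) / heat (s + h) F x" for w
  define l where "l w = \<alpha> \<bullet> w - (norm \<alpha>)\<^sup>2 / 2" for w
  have [measurable]: "g \<in> borel_measurable borel" "l \<in> borel_measurable borel" unfolding g_def l_def by measurable
  have gnn: "g w \<ge> 0" for w unfolding g_def using u[of x] G by (simp add: less_imp_le)
  have "(doob (s + h) F f x)\<^sup>2 = (\<integral>\<^sup>+w. ennreal (g w) * V (x + sqrt h *\<^sub>R w) \<partial>std_gauss)\<^sup>2"
    using h by (subst doob_chapman_kolmogorov[OF K F s]) (auto simp: g_def V_def)
  also have "\<dots> = (\<integral>\<^sup>+w. ennreal (g w * exp (- l w / 2)) * (V (x + sqrt h *\<^sub>R w) * ennreal (exp (l w / 2))) \<partial>std_gauss)\<^sup>2"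
  proof -
    have "ennreal (g w * exp (- l w / 2)) * (V (x + sqrt h *\<^sub>R w) * ennreal (exp (l w / 2))) = ennreal (g w) * V (x + sqrt h *\<^sub>R w)" for w
    proof -
      have "ennreal (g w * exp (- l w / 2)) * (V (x + sqrt h *\<^sub>R w) * ennreal (exp (l w / 2)))
          = ennreal (g w * exp (- l w / 2) * exp (l w / 2)) * V (x + sqrt h *\<^sub>R w)"
        using gnn[of w] by (simp add: ennreal_mult mult_ac)
      also have "g w * exp (- l w / 2) * exp (l w / 2) = g w"
        by (simp add: mult.assoc exp_add[symmetric])
      finally show ?thesis .
    qed
    thus ?thesis by simp
  qed
  also have "\<dots> \<le> (\<integral>\<^sup>+w. (ennreal (g w * exp (- l w / 2)))\<^sup>2 \<partial>std_gauss)
      * (\<integral>\<^sup>+w. (V (x + sqrt h *\<^sub>R w) * ennreal (exp (l w / 2)))\<^sup>2 \<partial>std_gauss)"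
    by (rule Cauchy_Schwarz_nn_integral) measurable
  also have "(\<integral>\<^sup>+w. (ennreal (g w * exp (- l w / 2)))\<^sup>2 \<partial>std_gauss)
      = (\<integral>\<^sup>+w. ennreal ((g w)\<^sup>2 * exp (- l w)) \<partial>std_gauss)"
    using gnn by (intro nn_integral_cong) (simp add: ennreal_power power_mult_distrib exp_double[symmetric])
  also have "(\<integral>\<^sup>+w. (V (x + sqrt h *\<^sub>R w) * ennreal (exp (l w / 2)))\<^sup>2 \<partial>std_gauss)
      = (\<integral>\<^sup>+w. (V (x + sqrt h *\<^sub>R w))\<^sup>2 * ennreal (exp (l w)) \<partial>std_gauss)"
    by (intro nn_integral_cong) (simp add: power_mult_distrib ennreal_power exp_double[symmetric])
  also have "\<dots> = (\<integral>\<^sup>+z. (V (x + sqrt h *\<^sub>R (z + \<alpha>)))\<^sup>2 * ennreal (exp (l (z + \<alpha>)))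
                   * ennreal (exp (- (\<alpha> \<bullet> z) - (norm \<alpha>)\<^sup>2 / 2)) \<partial>std_gauss)"
    by (rule nn_integral_std_gauss_shift) measurable
  also have "\<dots> = (\<integral>\<^sup>+z. (V (x + h *\<^sub>R b + sqrt h *\<^sub>R z))\<^sup>2 \<partial>std_gauss)"
  proof (rule nn_integral_cong)
    fix z
    have "l (z + \<alpha>) + (- (\<alpha> \<bullet> z) - (norm \<alpha>)\<^sup>2 / 2) = 0"
      by (simp add: l_def inner_add_right power2_norm_eq_inner)
    hence "ennreal (exp (l (z + \<alpha>))) * ennreal (exp (- (\<alpha> \<bullet> z) - (norm \<alpha>)\<^sup>2 / 2)) = 1"
      by (simp add: ennreal_mult[symmetric] exp_add[symmetric])
    moreover have "x + sqrt h *\<^sub>R (z + \<alpha>) = x + h *\<^sub>R b + sqrt h *\<^sub>R z"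
      using h by (simp add: \<alpha>_def scaleR_add_right)
    ultimately show "(V (x + sqrt h *\<^sub>R (z + \<alpha>)))\<^sup>2 * ennreal (exp (l (z + \<alpha>)))
                   * ennreal (exp (- (\<alpha> \<bullet> z) - (norm \<alpha>)\<^sup>2 / 2)) = (V (x + h *\<^sub>R b + sqrt h *\<^sub>R z))\<^sup>2"
      by (simp add: mult.assoc add.assoc)
  qed
  also have "(\<integral>\<^sup>+w. ennreal ((g w)\<^sup>2 * exp (- l w)) \<partial>std_gauss) = euler_ratio_moment s h F x"
    unfolding euler_ratio_moment_def Let_def g_def l_def \<alpha>_def b_def ..
  finally show ?thesis by (simp add: V_def b_def)
qed

section \<open>Chaining the steps\<close>

lemma euler_maruyama_cong:
  assumes "\<And>j. j \<in> {1..i} \<Longrightarrow> Z j w = Z' j w'"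
  shows "euler_maruyama b T n Z i w = euler_maruyama b T n Z' i w'"
  using assms by (induction i) auto

lemma euler_maruyama_measurable:
  fixes b :: "real \<Rightarrow> 'a::euclidean_space \<Rightarrow> 'a"
  assumes Z: "\<And>j. j \<in> {1..i} \<Longrightarrow> Z j \<in> borel_measurable N"
    and b: "\<And>j. j < i \<Longrightarrow> b (real j * T / real n) \<in> borel_measurable borel"
  shows "euler_maruyama b T n Z i \<in> borel_measurable N"
  using assms
proof (induction i)
  case 0
  have "euler_maruyama b T n Z 0 = (\<lambda>_. 0)" by (rule ext) simp
  then show ?case by simp
next
  case (Suc i)
  have [measurable]: "euler_maruyama b T n Z i \<in> borel_measurable N" by (rule Suc.IH) (use Suc.prems in auto)
  have [measurable]: "b (real i * T / real n) \<in> borel_measurable borel" using Suc.prems by auto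
  have [measurable]: "Z (Suc i) \<in> borel_measurable N" using Suc.prems by auto
  show ?case by (simp cong: measurable_cong)
qed

text \<open>The Markov property: the \<open>i\<close>th iterate is a function of the first \<open>i\<close> noise variables, hence
  independent of the next one.\<close>
lemma (in prob_space) euler_maruyama_step:
  fixes b :: "real \<Rightarrow> 'b::euclidean_space \<Rightarrow> 'b" and f :: "'b \<Rightarrow> ennreal"
  assumes Z: "indep_vars (\<lambda>_. borel) Z {1..n}" "\<And>j. j \<in> {1..n} \<Longrightarrow> distr M borel (Z j) = std_gauss"
    and b: "\<And>j. j < n \<Longrightarrow> b (real j * T / real n) \<in> borel_measurable borel"
    and i: "i < n" and [measurable]: "f \<in> borel_measurable borel"
  shows "(\<integral>\<^sup>+w. f (euler_maruyama b T n Z (Suc i) w) \<partial>M)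
       = (\<integral>\<^sup>+w. (\<integral>\<^sup>+z. f (euler_maruyama b T n Z i w
              + (T / real n) *\<^sub>R b (real i * T / real n) (euler_maruyama b T n Z i w)
              + sqrt (T / real n) *\<^sub>R z) \<partial>std_gauss) \<partial>M)"
proof -
  define Y where "Y = euler_maruyama b T n Z i"
  define y where "y = euler_maruyama b T n (\<lambda>j (x::nat \<Rightarrow> 'b). x j) i"
  have Zm: "j \<in> {1..n} \<Longrightarrow> Z j \<in> borel_measurable M" for j
    using Z(1) by (auto simp: indep_vars_def)
  have [measurable]: "Z (Suc i) \<in> borel_measurable M" using Zm i by auto
  have [measurable]: "Y \<in> borel_measurable M"
    unfolding Y_def using Zm b i by (intro euler_maruyama_measurable) auto
  have [measurable]: "b (real i * T / real n) \<in> borel_measurable borel" by (rule b[OF i])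
  have ym: "y \<in> measurable (PiM {1..i} (\<lambda>_. borel)) borel"
    unfolding y_def using b i by (intro euler_maruyama_measurable measurable_component_singleton) auto
  have "indep_var (PiM {1..i} (\<lambda>_. borel)) (\<lambda>w. restrict (\<lambda>j. Z j w) {1..i})
                  (PiM {Suc i} (\<lambda>_. borel)) (\<lambda>w. restrict (\<lambda>j. Z j w) {Suc i})"
    by (rule indep_var_restrict[OF Z(1)]) (use i in auto)
  hence "indep_var borel (y \<circ> (\<lambda>w. restrict (\<lambda>j. Z j w) {1..i}))
                   borel ((\<lambda>x. x (Suc i)) \<circ> (\<lambda>w. restrict (\<lambda>j. Z j w) {Suc i}))"
    by (rule indep_var_compose) (use ym in auto)
  moreover have "y \<circ> (\<lambda>w. restrict (\<lambda>j. Z j w) {1..i}) = Y"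
    by (rule ext) (auto simp: y_def Y_def intro!: euler_maruyama_cong)
  moreover have "(\<lambda>x. x (Suc i)) \<circ> (\<lambda>w. restrict (\<lambda>j. Z j w) {Suc i}) = Z (Suc i)" by auto
  ultimately have "indep_var borel Y borel (Z (Suc i))" by simp
  hence joint: "distr M (borel \<Otimes>\<^sub>M borel) (\<lambda>w. (Y w, Z (Suc i) w)) = distr M borel Y \<Otimes>\<^sub>M std_gauss"
    using Z(2)[of "Suc i"] i by (simp add: indep_var_distribution_eq)
  define g where "g p = f (fst p + (T / real n) *\<^sub>R b (real i * T / real n) (fst p) + sqrt (T / real n) *\<^sub>R snd p)" for p
  have gm: "g \<in> borel_measurable (borel \<Otimes>\<^sub>M borel)" unfolding g_def by measurable
  have [measurable]: "g \<in> borel_measurable (distr M borel Y \<Otimes>\<^sub>M std_gauss)"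
    using gm by (subst measurable_cong_sets[OF sets_pair_measure_cong refl]) auto
  have "(\<integral>\<^sup>+w. f (euler_maruyama b T n Z (Suc i) w) \<partial>M) = (\<integral>\<^sup>+w. g (Y w, Z (Suc i) w) \<partial>M)"
    by (simp add: g_def Y_def)
  also have "\<dots> = (\<integral>\<^sup>+p. g p \<partial>distr M (borel \<Otimes>\<^sub>M borel) (\<lambda>w. (Y w, Z (Suc i) w)))"
    using gm by (subst nn_integral_distr) auto
  also have "\<dots> = (\<integral>\<^sup>+p. g p \<partial>(distr M borel Y \<Otimes>\<^sub>M std_gauss))" by (simp only: joint)
  also have "\<dots> = (\<integral>\<^sup>+y. (\<integral>\<^sup>+z. g (y, z) \<partial>std_gauss) \<partial>distr M borel Y)"
    by (rule std_gauss.nn_integral_fst[symmetric]) measurable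
  also have "\<dots> = (\<integral>\<^sup>+w. (\<integral>\<^sup>+z. g (Y w, z) \<partial>std_gauss) \<partial>M)"
    unfolding g_def by (subst nn_integral_distr) auto
  finally show ?thesis by (simp add: g_def Y_def)
qed

text \<open>The constant \<open>C\<close> is a parameter, with the one-step bound as a hypothesis, so that the same \<open>C\<close>
  serves for every \<open>n\<close>. The time remaining after step \<open>j\<close> is \<open>(n - 1 - j) h\<close>, which gives the factors of
  the product.\<close>
lemma (in prob_space) doob_euler_maruyama:
  fixes F :: "'b::euclidean_space \<Rightarrow> real" and f :: "'b \<Rightarrow> ennreal"
  assumes K: "K \<ge> 0" and F: "log_lipschitz K F" and T: "T > 0"
    and Z: "indep_vars (\<lambda>_. borel) Z {1..n}" "\<And>j. j \<in> {1..n} \<Longrightarrow> distr M borel (Z j) = std_gauss"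
    and b: "\<And>t. t < T \<Longrightarrow> b t = heat_drift (T - t) F"
    and [measurable]: "f \<in> borel_measurable borel"
    and C: "\<And>s h x. 0 \<le> s \<Longrightarrow> 0 < h \<Longrightarrow> s + h \<le> T \<Longrightarrow>
       euler_ratio_moment s h F x \<le> ennreal (1 + C * (h\<^sup>2 / max s h))" and "C > 0"
    and i: "i \<le> n" and n: "n > 0"
  shows "(doob T F f 0)\<^sup>2 \<le> ennreal (\<Prod>j<i. 1 + C * T / (real n * max 1 (real (n - Suc j))))
      * (\<integral>\<^sup>+w. (doob (T - real i * T / real n) F f (euler_maruyama b T n Z i w))\<^sup>2 \<partial>M)"
  using i
proof (induction i)
  case 0
  then show ?case by (simp add: emeasure_space_1)
next
  case (Suc i)
  note [measurable] = log_lipschitzD(1)[OF K F] heat_measurable[OF K F]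
  define h where "h = T / real n"
  define s where "s = T - real (Suc i) * T / real n"
  have i: "i < n" using Suc.prems by simp
  have h: "h > 0" using T n by (simp add: h_def)
  have s_eq: "s = real (n - Suc i) * h"
    using i n by (simp add: s_def h_def of_nat_diff field_simps)
  have s: "s \<ge> 0" unfolding s_eq using h by simp
  have sh: "s + h = T - real i * T / real n"
    using n by (simp add: s_def h_def field_simps)
  have shT: "s + h \<le> T" unfolding sh using T by simp
  have hs: "h\<^sup>2 / max s h = T / (real n * max 1 (real (n - Suc i)))"
  proof -
    have "max s h = h * max 1 (real (n - Suc i))"
    proof -
      have "real (n - Suc i) * h = h * real (n - Suc i)" by simp
      moreover have "h * max 1 (real (n - Suc i)) = max (h * 1) (h * real (n - Suc i))"
        using h by (auto simp: max_def)
      ultimately show ?thesis unfolding s_eq by (simp add: max.commute mult.commute)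
    qed
    thus ?thesis using h by (simp add: power2_eq_square) (simp add: h_def)
  qed
  have step: "euler_ratio_moment s h F x \<le> ennreal (1 + C * T / (real n * max 1 (real (n - Suc i))))" for x
    using C[OF s h shT, of x] unfolding hs times_divide_eq_right .
  define a where "a j = 1 + C * T / (real n * max 1 (real (n - Suc j)))" for j
  have a: "a j \<ge> 0" for j using \<open>C > 0\<close> T by (simp add: a_def)
  define Y where "Y = euler_maruyama b T n Z"
  have Zm: "j \<in> {1..n} \<Longrightarrow> Z j \<in> borel_measurable M" for j
    using Z(1) by (auto simp: indep_vars_def)
  have bm: "b (real j * T / real n) \<in> borel_measurable borel" if "j < n" for j
  proof -
    have "real j * T / real n < T" using that T by (simp add: field_simps)
    thus ?thesis by (subst b) (auto simp: heat_drift_measurable[OF K F])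
  qed
  have [measurable]: "Y i \<in> borel_measurable M"
    unfolding Y_def using Zm bm i by (intro euler_maruyama_measurable) auto
  note [measurable] = bm[OF i]
  have bi: "b (real i * T / real n) = heat_drift (s + h) F"
    unfolding sh using i T by (intro b) (simp add: field_simps)
  have "(\<integral>\<^sup>+w. (doob (T - real i * T / real n) F f (Y i w))\<^sup>2 \<partial>M)
      \<le> (\<integral>\<^sup>+w. ennreal (a i) * (\<integral>\<^sup>+z. (doob s F f (Y i w
              + h *\<^sub>R b (real i * T / real n) (Y i w) + sqrt h *\<^sub>R z))\<^sup>2 \<partial>std_gauss) \<partial>M)"
    unfolding sh[symmetric] bi a_def
    by (intro nn_integral_mono order.trans[OF doob_square_le[OF K F s h] mult_right_mono[OF step]]) auto
  also have "\<dots> = ennreal (a i) * (\<integral>\<^sup>+w. (\<integral>\<^sup>+z. (doob s F f (Y i w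
              + h *\<^sub>R b (real i * T / real n) (Y i w) + sqrt h *\<^sub>R z))\<^sup>2 \<partial>std_gauss) \<partial>M)"
    by (intro nn_integral_cmult) measurable
  also have "(\<integral>\<^sup>+w. (\<integral>\<^sup>+z. (doob s F f (Y i w
              + h *\<^sub>R b (real i * T / real n) (Y i w) + sqrt h *\<^sub>R z))\<^sup>2 \<partial>std_gauss) \<partial>M)
      = (\<integral>\<^sup>+w. (doob s F f (Y (Suc i) w))\<^sup>2 \<partial>M)"
    unfolding Y_def h_def
    by (rule euler_maruyama_step[of Z n b T i "\<lambda>x. (doob s F f x)\<^sup>2", OF Z bm i, symmetric]) auto
  finally have le: "(\<integral>\<^sup>+w. (doob (T - real i * T / real n) F f (Y i w))\<^sup>2 \<partial>M)
      \<le> ennreal (a i) * (\<integral>\<^sup>+w. (doob s F f (Y (Suc i) w))\<^sup>2 \<partial>M)" .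
  have "(doob T F f 0)\<^sup>2 \<le> ennreal (\<Prod>j<i. a j) * (\<integral>\<^sup>+w. (doob (T - real i * T / real n) F f (Y i w))\<^sup>2 \<partial>M)"
    using Suc.IH i by (simp add: a_def Y_def)
  also have "\<dots> \<le> ennreal (\<Prod>j<i. a j) * (ennreal (a i) * (\<integral>\<^sup>+w. (doob s F f (Y (Suc i) w))\<^sup>2 \<partial>M))"
    by (intro mult_left_mono le) simp
  also have "\<dots> = ennreal (\<Prod>j<Suc i. a j) * (\<integral>\<^sup>+w. (doob s F f (Y (Suc i) w))\<^sup>2 \<partial>M)"
    using a by (simp add: ennreal_mult prod_nonneg mult.assoc)
  finally show ?case by (simp add: a_def Y_def s_def)
qed

section \<open>From second moments to total variation\<close>

text \<open>The singularity \<open>1 / max s h\<close> of the one-step cost only produces a harmonic sum, so the total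
  cost is of order \<open>ln n / n\<close>.\<close>
lemma prod_le_exp_harm:
  assumes "C \<ge> 0" "T \<ge> 0" "n > 0"
  shows "(\<Prod>j<n. 1 + C * T / (real n * max 1 (real (n - Suc j)))) \<le> exp (C * T * ((1 + harm n) / real n))"
proof -
  have "(\<Prod>j<n. 1 + C * T / (real n * max 1 (real (n - Suc j))))
      \<le> (\<Prod>j<n. exp (C * T / (real n * max 1 (real (n - Suc j)))))"
    using assms by (intro prod_mono) (auto intro!: add_nonneg_nonneg divide_nonneg_nonneg exp_ge_add_one_self)
  also have "\<dots> = exp (\<Sum>j<n. C * T / real n * (1 / max 1 (real (n - Suc j))))"
    by (simp add: exp_sum)
  also have "(\<Sum>j<n. C * T / real n * (1 / max 1 (real (n - Suc j)))) = C * T / real n * (\<Sum>j<n. 1 / max 1 (real j))"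
    unfolding sum_distrib_left[symmetric] using sum.nat_diff_reindex[of "\<lambda>j. 1 / max 1 (real j)" n] by simp
  also have "(\<Sum>j<n. 1 / max 1 (real j)) \<le> 1 + harm n"
  proof -
    obtain m where m: "n = Suc m" using assms(3) by (cases n) auto
    have "(\<Sum>j<n. 1 / max 1 (real j)) = 1 + (\<Sum>j<m. 1 / max 1 (real (Suc j)))"
      unfolding m by (subst sum.lessThan_Suc_shift) simp
    also have "(\<Sum>j<m. 1 / max 1 (real (Suc j))) = (\<Sum>j\<in>{1..m}. inverse (real j))"
      by (rule sum.reindex_bij_witness[of _ "\<lambda>j. j - 1" Suc]) (auto simp: field_simps max_def)
    also have "\<dots> \<le> harm n" unfolding harm_def m by (intro sum_mono2) auto
    finally show ?thesis by simp
  qed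
  finally show ?thesis using assms by (simp add: mult_left_mono divide_right_mono)
qed

lemma harm_over_n_tendsto_0: "(\<lambda>n. (1 + harm n) / real n) \<longlonglongrightarrow> 0"
proof (rule tendsto_sandwich[of "\<lambda>_. 0" _ _ "\<lambda>n. 2 / real n + ln (real n) / real n"])
  show "\<forall>\<^sub>F n in sequentially. (1 + harm n) / real n \<le> 2 / real n + ln (real n) / real n"
    using eventually_gt_at_top[of 0]
  proof eventually_elim
    case (elim n)
    obtain m where m: "n = Suc m" using elim by (cases n) auto
    have "harm n \<le> ln (real n) + 1"
      using decseqD[OF decseq_harm_diff_ln, of 0 m] by (simp add: m harm_Suc harm_expand(1))
    thus ?case using elim by (simp add: add_divide_distrib[symmetric] divide_right_mono)
  qed
  show "(\<lambda>n. 2 / real n + ln (real n) / real n) \<longlonglongrightarrow> 0"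
    using tendsto_add[OF lim_const_over_n[of 2] lim_ln_over_n] by simp
qed (auto simp: harm_nonneg)

text \<open>The hypothesis is the inequality \<open>(P f)\<^sup>2 \<le> (1 + \<kappa>) Q (f\<^sup>2)\<close> for \<open>f = 1 + t (1\<^sub>A - q)\<close>, where \<open>A\<close>
  has probabilities \<open>p\<close> and \<open>q\<close> under \<open>P\<close> and \<open>Q\<close>. For small \<open>\<kappa>\<close> and \<open>t\<close> it essentially reads \<open>2 t (p - q) \<le> \<kappa> + t\<^sup>2/4\<close>,
  so \<open>t\<close> should be of size \<open>\<surd>\<kappa>\<close>, with the sign of \<open>p - q\<close>. The restriction \<open>|t| \<le> 1\<close> keeps \<open>f\<close>
  nonnegative.\<close>
lemma abs_diff_le_sqrt_of_square_bound:
  fixes p q \<kappa> :: real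
  assumes p: "0 \<le> p" "p \<le> 1" and q: "0 \<le> q" "q \<le> 1" and \<kappa>: "\<kappa> > 0"
    and sq: "\<And>t. \<bar>t\<bar> \<le> 1 \<Longrightarrow> (1 + t * (p - q))\<^sup>2 \<le> (1 + \<kappa>) * (1 + t\<^sup>2 * (q * (1 - q)))"
  shows "\<bar>p - q\<bar> \<le> sqrt \<kappa>"
proof (cases "\<kappa> \<ge> 1")
  case True
  hence "1 \<le> sqrt \<kappa>" by simp
  thus ?thesis using p q by linarith
next
  case False
  define r where "r = sqrt \<kappa>"
  have r: "r > 0" "r\<^sup>2 = \<kappa>" "r \<le> 1" using False \<kappa> by (auto simp: r_def)
  \<comment> \<open>The nearly optimal choice, available because \<open>r \<le> 1\<close> here; for \<open>\<kappa> \<ge> 1\<close> the claim is trivial.\<close>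
  define t where "t = (if p \<ge> q then r else - r)"
  have t: "\<bar>t\<bar> \<le> 1" "t\<^sup>2 = \<kappa>" "t * (p - q) = r * \<bar>p - q\<bar>"
    using r by (auto simp: t_def algebra_simps)
  have "q * (1 - q) \<le> 1 / 4"
    using zero_le_power2[of "q - 1/2"] by (simp add: power2_eq_square algebra_simps)
  hence "\<kappa> * (q * (1 - q)) \<le> \<kappa> * (1 / 4)" using \<kappa> by (intro mult_left_mono) auto
  hence "(1 + \<kappa>) * (1 + t\<^sup>2 * (q * (1 - q))) \<le> (1 + \<kappa>) * (1 + \<kappa> / 4)"
    using \<kappa> t by (intro mult_left_mono) auto
  also have "\<dots> \<le> 1 + 2 * \<kappa>"
  proof -
    have "\<kappa> * \<kappa> \<le> \<kappa> * 1" using False \<kappa> by (intro mult_left_mono) auto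
    thus ?thesis using \<kappa> by (simp add: algebra_simps)
  qed
  finally have "(1 + t * (p - q))\<^sup>2 \<le> 1 + 2 * \<kappa>" using sq[OF t(1)] by linarith
  moreover have "1 + 2 * (t * (p - q)) \<le> (1 + t * (p - q))\<^sup>2"
    using zero_le_power2[of "t * (p - q)"] by (simp add: power2_eq_square algebra_simps)
  ultimately have "r * \<bar>p - q\<bar> \<le> r * r" using t r by (simp add: power2_eq_square)
  hence "\<bar>p - q\<bar> \<le> r" using r(1) by (simp only: mult_le_cancel_left_pos)
  thus ?thesis by (simp add: r_def)
qed

lemma tv_dist_bdd:
  assumes "prob_space \<nu>1" "prob_space \<nu>2"
  shows "\<bar>measure \<nu>1 A - measure \<nu>2 A\<bar> \<le> 1"
  using prob_space.prob_le_1[OF assms(1), of A] prob_space.prob_le_1[OF assms(2), of A]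
    measure_nonneg[of \<nu>1 A] measure_nonneg[of \<nu>2 A] by linarith

lemma tv_dist_upper:
  assumes "prob_space \<nu>1" "prob_space \<nu>2" "A \<in> sets borel"
  shows "\<bar>measure \<nu>1 A - measure \<nu>2 A\<bar> \<le> tv_dist \<nu>1 \<nu>2"
  unfolding tv_dist_def using assms tv_dist_bdd[OF assms(1,2)]
  by (intro cSUP_upper) (auto intro!: bdd_aboveI2[where M=1])

lemma tv_dist_least:
  assumes "\<And>A. A \<in> sets borel \<Longrightarrow> \<bar>measure \<nu>1 A - measure \<nu>2 A\<bar> \<le> c"
  shows "tv_dist \<nu>1 \<nu>2 \<le> c"
  unfolding tv_dist_def by (rule cSUP_least) (use assms in auto)

text \<open>Triangle inequality for the total variation distance, in the form used to pass to the limit in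
  one argument.\<close>
lemma tv_dist_perturb:
  assumes "prob_space \<nu>1" "prob_space \<nu>2" "prob_space \<mu>"
  shows "\<bar>tv_dist \<nu>1 \<mu> - tv_dist \<nu>2 \<mu>\<bar> \<le> tv_dist \<nu>1 \<nu>2"
proof -
  have "tv_dist \<nu>1 \<mu> \<le> tv_dist \<nu>1 \<nu>2 + tv_dist \<nu>2 \<mu>"
  proof (rule tv_dist_least)
    fix A :: "'a set" assume A: "A \<in> sets borel"
    show "\<bar>measure \<nu>1 A - measure \<mu> A\<bar> \<le> tv_dist \<nu>1 \<nu>2 + tv_dist \<nu>2 \<mu>"
      using tv_dist_upper[OF assms(1,2) A] tv_dist_upper[OF assms(2,3) A] by linarith
  qed
  moreover have "tv_dist \<nu>2 \<mu> \<le> tv_dist \<nu>1 \<nu>2 + tv_dist \<nu>1 \<mu>"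
  proof (rule tv_dist_least)
    fix A :: "'a set" assume A: "A \<in> sets borel"
    show "\<bar>measure \<nu>2 A - measure \<mu> A\<bar> \<le> tv_dist \<nu>1 \<nu>2 + tv_dist \<nu>1 \<mu>"
      using tv_dist_upper[OF assms(1,2) A] tv_dist_upper[OF assms(1,3) A] by linarith
  qed
  ultimately show ?thesis by linarith
qed

lemma (in prob_space) nn_integral_affine_indicator:
  assumes A: "A \<in> sets M" and t: "\<bar>t\<bar> \<le> 1" and q: "0 \<le> q" "q \<le> (1::real)"
  shows "(\<integral>\<^sup>+y. ennreal (1 + t * (indicator A y - q)) \<partial>M) = ennreal (1 + t * (prob A - q))"
    and "prob A = q \<Longrightarrow> (\<integral>\<^sup>+y. (ennreal (1 + t * (indicator A y - q)))\<^sup>2 \<partial>M) = ennreal (1 + t\<^sup>2 * (q * (1 - q)))"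
proof -
  have nn: "0 \<le> 1 + t * (indicator A y - q)" for y
  proof -
    have "\<bar>t * (indicator A y - q)\<bar> \<le> 1 * 1"
      unfolding abs_mult using t q by (intro mult_mono) (auto simp: indicator_def)
    thus ?thesis by linarith
  qed
  have i: "integrable M (\<lambda>y. indicator A y :: real)" using A by (simp add: emeasure_eq_measure)
  have "(\<integral>\<^sup>+y. ennreal (1 + t * (indicator A y - q)) \<partial>M) = ennreal (\<integral>y. 1 + t * (indicator A y - q) \<partial>M)"
    using nn i by (intro nn_integral_eq_integral) auto
  thus "(\<integral>\<^sup>+y. ennreal (1 + t * (indicator A y - q)) \<partial>M) = ennreal (1 + t * (prob A - q))"
    using i A by (simp add: prob_space)
  assume pq: "prob A = q"
  have sq: "(1 + t * (indicator A y - q))\<^sup>2 = (1 - t * q)\<^sup>2 + (2 * t + t\<^sup>2 - 2 * t\<^sup>2 * q) * indicator A y" for y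
    by (auto simp: indicator_def power2_eq_square algebra_simps)
  have "(\<integral>\<^sup>+y. (ennreal (1 + t * (indicator A y - q)))\<^sup>2 \<partial>M)
      = ennreal (\<integral>y. (1 + t * (indicator A y - q))\<^sup>2 \<partial>M)"
    unfolding ennreal_power[OF nn]
  proof (rule nn_integral_eq_integral)
    show "integrable M (\<lambda>y. (1 + t * (indicator A y - q))\<^sup>2)" unfolding sq using i by simp
  qed simp
  also have "(\<integral>y. (1 + t * (indicator A y - q))\<^sup>2 \<partial>M) = 1 + t\<^sup>2 * (q * (1 - q))"
    unfolding sq using i A by (simp add: prob_space pq power2_eq_square algebra_simps)
  finally show "(\<integral>\<^sup>+y. (ennreal (1 + t * (indicator A y - q)))\<^sup>2 \<partial>M) = ennreal (1 + t\<^sup>2 * (q * (1 - q)))" .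
qed

lemma (in prob_space) tv_dist_euler_maruyama_le:
  fixes F :: "'b::euclidean_space \<Rightarrow> real" and \<nu> :: "'b measure"
  assumes K: "K \<ge> 0" and F: "log_lipschitz K F" and T: "T > 0"
    and Z: "indep_vars (\<lambda>_. borel) Z {1..n}" "\<And>j. j \<in> {1..n} \<Longrightarrow> distr M borel (Z j) = std_gauss"
    and b: "\<And>t. t < T \<Longrightarrow> b t = heat_drift (T - t) F"
    and C: "\<And>s h x. 0 \<le> s \<Longrightarrow> 0 < h \<Longrightarrow> s + h \<le> T \<Longrightarrow>
       euler_ratio_moment s h F x \<le> ennreal (1 + C * (h\<^sup>2 / max s h))" and "C > 0"
    and n: "n > 0"
    and \<nu>: "prob_space \<nu>" "sets \<nu> = sets borel"
      "\<And>f. f \<in> borel_measurable borel \<Longrightarrow> doob T F f 0 = (\<integral>\<^sup>+y. f y \<partial>\<nu>)"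
  shows "tv_dist (distr M borel (euler_maruyama b T n Z n)) \<nu> \<le> sqrt (exp (C * T * ((1 + harm n) / real n)) - 1)"
proof (rule tv_dist_least)
  fix A :: "'b set" assume A [measurable]: "A \<in> sets borel"
  note [measurable] = heat_measurable[OF K F]
  define \<kappa> where "\<kappa> = exp (C * T * ((1 + harm n) / real n)) - 1"
  have \<kappa>: "\<kappa> > 0" using \<open>C > 0\<close> T n by (auto simp: \<kappa>_def intro!: mult_pos_pos divide_pos_pos add_pos_nonneg harm_nonneg)
  define Y where "Y = euler_maruyama b T n Z n"
  have Zm: "j \<in> {1..n} \<Longrightarrow> Z j \<in> borel_measurable M" for j
    using Z(1) by (auto simp: indep_vars_def)
  have bm: "b (real j * T / real n) \<in> borel_measurable borel" if "j < n" for j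
  proof -
    have "real j * T / real n < T" using that T by (simp add: field_simps)
    thus ?thesis by (subst b) (auto simp: heat_drift_measurable[OF K F])
  qed
  have [measurable]: "Y \<in> borel_measurable M"
    unfolding Y_def using Zm bm by (intro euler_maruyama_measurable) auto
  define q where "q = measure (distr M borel Y) A"
  define p where "p = measure \<nu> A"
  interpret D: prob_space "distr M borel Y" by (rule prob_space_distr) simp
  interpret N: prob_space \<nu> by (rule \<nu>)
  have pq: "0 \<le> p" "p \<le> 1" "0 \<le> q" "q \<le> 1" by (simp_all add: p_def q_def)
  have "\<bar>p - q\<bar> \<le> sqrt \<kappa>"
  proof (rule abs_diff_le_sqrt_of_square_bound[OF pq \<kappa>])
    fix t :: real assume t: "\<bar>t\<bar> \<le> 1"
    define f :: "'b \<Rightarrow> ennreal" where "f y = ennreal (1 + t * (indicator A y - q))" for y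
    have fm [measurable]: "f \<in> borel_measurable borel" unfolding f_def by measurable
    have "doob T F f 0 = ennreal (1 + t * (p - q))"
      unfolding \<nu>(3)[OF fm] f_def p_def
      using N.nn_integral_affine_indicator(1)[of A t q] t pq A \<nu>(2) by simp
    moreover have "(\<integral>\<^sup>+w. (doob (T - real n * T / real n) F f (Y w))\<^sup>2 \<partial>M) = ennreal (1 + t\<^sup>2 * (q * (1 - q)))"
    proof -
      have "(\<integral>\<^sup>+w. (doob (T - real n * T / real n) F f (Y w))\<^sup>2 \<partial>M) = (\<integral>\<^sup>+w. (f (Y w))\<^sup>2 \<partial>M)"
        using n by (simp add: doob_zero log_lipschitzD(2)[OF K F])
      also have "\<dots> = (\<integral>\<^sup>+y. (f y)\<^sup>2 \<partial>distr M borel Y)" by (subst nn_integral_distr) auto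
      also have "\<dots> = ennreal (1 + t\<^sup>2 * (q * (1 - q)))"
      proof -
        have "A \<in> sets (distr M borel Y)" "measure (distr M borel Y) A = q" by (simp_all add: q_def)
        thus ?thesis unfolding f_def by (intro D.nn_integral_affine_indicator(2) t pq(3,4))
      qed
      finally show ?thesis .
    qed
    moreover have "(doob T F f 0)\<^sup>2 \<le> ennreal (\<Prod>j<n. 1 + C * T / (real n * max 1 (real (n - Suc j))))
      * (\<integral>\<^sup>+w. (doob (T - real n * T / real n) F f (Y w))\<^sup>2 \<partial>M)"
      unfolding Y_def by (rule doob_euler_maruyama[OF K F T Z b fm C \<open>C > 0\<close> order.refl n])
    moreover have "ennreal (\<Prod>j<n. 1 + C * T / (real n * max 1 (real (n - Suc j)))) \<le> ennreal (1 + \<kappa>)"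
      unfolding \<kappa>_def using prod_le_exp_harm[of C T n] \<open>C > 0\<close> T n by (intro ennreal_leI) simp
    ultimately have le: "(ennreal (1 + t * (p - q)))\<^sup>2 \<le> ennreal (1 + \<kappa>) * ennreal (1 + t\<^sup>2 * (q * (1 - q)))"
      by (simp only:) (erule order.trans, rule mult_right_mono, assumption, simp)
    have "\<bar>t * (p - q)\<bar> \<le> 1 * 1"
      unfolding abs_mult using t pq by (intro mult_mono) auto
    hence nn: "0 \<le> 1 + t * (p - q)" by linarith
    have \<kappa>': "0 \<le> 1 + \<kappa>" using \<kappa> by simp
    have v: "0 \<le> 1 + t\<^sup>2 * (q * (1 - q))"
      using pq by (intro add_nonneg_nonneg mult_nonneg_nonneg) auto
    have "ennreal ((1 + t * (p - q))\<^sup>2) \<le> ennreal ((1 + \<kappa>) * (1 + t\<^sup>2 * (q * (1 - q))))"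
      using le unfolding ennreal_power[OF nn] ennreal_mult[OF \<kappa>' v] .
    thus "(1 + t * (p - q))\<^sup>2 \<le> (1 + \<kappa>) * (1 + t\<^sup>2 * (q * (1 - q)))"
      by (rule iffD1[OF ennreal_le_iff[OF mult_nonneg_nonneg[OF \<kappa>' v]]])
  qed
  thus "\<bar>measure (distr M borel (euler_maruyama b T n Z n)) A - measure \<nu> A\<bar>
      \<le> sqrt (exp (C * T * ((1 + harm n) / real n)) - 1)"
    by (simp add: p_def q_def Y_def \<kappa>_def abs_minus_commute)
qed

section \<open>The scheme of the theorem\<close>

lemma distr_std_normal_vector:
  assumes "std_normal_vector M Z"
  shows "Z \<in> borel_measurable M" "distr M borel Z = std_gauss"
proof -
  have d: "distributed M lborel Z (\<lambda>x. ennreal (gauss_density 1 x))"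
    using assms by (simp add: std_normal_vector_def)
  show "Z \<in> borel_measurable M" using distributed_measurable[OF d] by simp
  have "distr M borel Z = distr M lborel Z" by (rule distr_cong) auto
  thus "distr M borel Z = std_gauss" using distributed_distr_eq_density[OF d] by (simp add: std_gauss_def)
qed

text \<open>The drift is written with \<open>\<phi>\<close>, for which neither smoothness nor integrability is evident; both
  come from the log-Lipschitz mixture, of which \<open>\<phi>\<close> is an affine function.\<close>
lemma drift_eq_heat_grad:
  fixes \<phi> :: "'a::euclidean_space \<Rightarrow> real"
  assumes K: "K \<ge> 0" and F: "log_lipschitz K (\<lambda>y. (1 - \<epsilon>) * \<phi> y + \<epsilon>)" (is "log_lipschitz K ?F")
    and \<epsilon>: "0 < \<epsilon>" "\<epsilon> < 1" and Z: "std_normal_vector M Z" and t: "t < T"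
  shows "drift M Z T \<phi> \<epsilon> t = heat_drift (T - t) ?F"
proof
  fix y
  define s where "s = T - t"
  have s: "s > 0" using t by (simp add: s_def)
  note [measurable] = distr_std_normal_vector(1)[OF Z]
  have \<phi>_eq: "\<phi> = (\<lambda>y. (?F y - \<epsilon>) / (1 - \<epsilon>))" using \<epsilon> by (intro ext) simp
  have \<phi>m [measurable]: "\<phi> \<in> borel_measurable borel"
  proof -
    have "(\<lambda>y. (?F y - \<epsilon>) / (1 - \<epsilon>)) \<in> borel_measurable borel"
      by (intro borel_measurable_divide borel_measurable_diff log_lipschitzD(1)[OF K F]) auto
    thus ?thesis using \<phi>_eq by simp
  qed
  have u: "(\<integral>w. \<phi> (x + sqrt s *\<^sub>R Z w) \<partial>M) = (heat s ?F x - \<epsilon>) / (1 - \<epsilon>)" for x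
  proof -
    have "(\<integral>w. \<phi> (x + sqrt s *\<^sub>R Z w) \<partial>M) = (\<integral>z. \<phi> (x + sqrt s *\<^sub>R z) \<partial>distr M borel Z)"
      by (subst integral_distr) auto
    also have "\<dots> = (\<integral>z. (?F (x + sqrt s *\<^sub>R z) - \<epsilon>) / (1 - \<epsilon>) \<partial>std_gauss)"
      unfolding distr_std_normal_vector(2)[OF Z] by (subst \<phi>_eq) simp
    also have "\<dots> = (\<integral>z. ?F (x + sqrt s *\<^sub>R z) - \<epsilon> \<partial>std_gauss) / (1 - \<epsilon>)" by simp
    also have "(\<integral>z. ?F (x + sqrt s *\<^sub>R z) - \<epsilon> \<partial>std_gauss) = heat s ?F x - (\<integral>z. \<epsilon> \<partial>(std_gauss::'a measure))"
      unfolding heat_def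
      by (rule Bochner_Integration.integral_diff[OF log_lipschitz_integrable(1)[OF K F]]) simp
    also have "(\<integral>z. \<epsilon> \<partial>(std_gauss::'a measure)) = \<epsilon>"
      using std_gauss.prob_space[where 'a='a] by simp
    finally show ?thesis .
  qed
  have "GDERIV (\<lambda>x. (heat s ?F x - \<epsilon>) / (1 - \<epsilon>)) y :> (1 / (1 - \<epsilon>)) *\<^sub>R heat_grad s ?F y"
  proof -
    have "((\<lambda>x. heat s ?F x) has_derivative (\<lambda>h. h \<bullet> heat_grad s ?F y)) (at y)"
      using gderiv_heat[OF K F s, of y] by (simp add: gderiv_def)
    hence "((\<lambda>x. (1 / (1 - \<epsilon>)) * (heat s ?F x - \<epsilon>)) has_derivative
        (\<lambda>h. (1 / (1 - \<epsilon>)) * (h \<bullet> heat_grad s ?F y - 0))) (at y)"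
      by (intro has_derivative_mult_right has_derivative_diff has_derivative_const)
    thus ?thesis by (simp add: gderiv_def)
  qed
  from grad_eqI[OF this] show "drift M Z T \<phi> \<epsilon> t y = heat_drift (T - t) ?F y"
    using \<epsilon> unfolding heat_drift_def drift_def Let_def s_def[symmetric] u by simp
qed

theorem theorem2p5:
  fixes M :: "'w measure"
    and T :: real
    and \<mu> :: "(real ^ 'd) measure"
    and \<rho> \<phi> :: "real ^ 'd \<Rightarrow> real"
    and Z\<^sub>0 :: "'w \<Rightarrow> real ^ 'd"
    and Z :: "real \<Rightarrow> nat \<Rightarrow> nat \<Rightarrow> 'w \<Rightarrow> real ^ 'd"
    and Y :: "real \<Rightarrow> nat \<Rightarrow> nat \<Rightarrow> 'w \<Rightarrow> real ^ 'd"
  assumes M: "prob_space M" "complete_measure M" "atomless M"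
    and T: "T > 0"
    and \<mu>: "prob_space \<mu>" "\<mu> = density lborel (\<lambda>y. ennreal (\<rho> y))"
    and \<rho>: "\<rho> \<in> borel_measurable borel" "\<And>y. \<rho> y \<ge> 0"
    and \<phi>: "\<And>y. \<phi> y = \<rho> y / gauss_density T y"
    and i: "integrable lborel (\<lambda>y. \<rho> y * ((norm y)\<^sup>2 + ln (\<rho> y)))"
    and ii: "\<exists>C\<^sub>1>0. \<forall>x y. \<bar>\<phi> x - \<phi> y\<bar> \<le> C\<^sub>1 * (1 + \<phi> x + \<phi> y) * norm (x - y)"
    and Z\<^sub>0: "std_normal_vector M Z\<^sub>0"
    and Z: "\<And>\<epsilon> n. \<epsilon> \<in> {0<..<1} \<Longrightarrow> prob_space.indep_vars M (\<lambda>_. borel) (Z \<epsilon> n) {1..n}"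
           "\<And>\<epsilon> n i. \<epsilon> \<in> {0<..<1} \<Longrightarrow> i \<in> {1..n} \<Longrightarrow> std_normal_vector M (Z \<epsilon> n i)"
    and Y: "\<And>\<epsilon> n i w. \<epsilon> \<in> {0<..<1} \<Longrightarrow> i \<le> n \<Longrightarrow> w \<in> space M \<Longrightarrow>
              Y \<epsilon> n i w = euler_maruyama (drift M Z\<^sub>0 T \<phi> \<epsilon>) T n (Z \<epsilon> n) i w"
  shows "(\<forall>\<epsilon>\<in>{0<..<1}. convergent (\<lambda>n. tv_dist (distr M borel (Y \<epsilon> n n)) \<mu>)) \<and>
         ((\<lambda>\<epsilon>. lim (\<lambda>n. tv_dist (distr M borel (Y \<epsilon> n n)) \<mu>)) \<longlongrightarrow> 0) (at_right 0)"
proof -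
  interpret M: prob_space M by (rule M)
  interpret \<mu>: prob_space \<mu> by (rule \<mu>)
  note [measurable] = \<rho>(1)
  have G: "gauss_density T y > 0" for y :: "real ^ 'd" by (rule gauss_density_pos[OF T])
  have \<phi>nn: "\<phi> y \<ge> 0" for y unfolding \<phi> using \<rho>(2)[of y] G[of y] by simp
  have [measurable]: "\<phi> \<in> borel_measurable borel" unfolding \<phi>[abs_def] by measurable
  obtain C\<^sub>1 where C\<^sub>1: "C\<^sub>1 > 0" "\<And>x y. \<bar>\<phi> x - \<phi> y\<bar> \<le> C\<^sub>1 * (1 + \<phi> x + \<phi> y) * norm (x - y)"
    using ii by blast
  define \<gamma>T :: "(real ^ 'd) measure" where "\<gamma>T = density lborel (\<lambda>y. ennreal (gauss_density T y))"
  have \<gamma>T: "prob_space \<gamma>T"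
    using nn_integral_gauss_density[OF T, of 0] by (intro prob_spaceI) (simp add: \<gamma>T_def emeasure_density)
  interpret \<gamma>T: prob_space \<gamma>T by (rule \<gamma>T)
  have \<mu>_sets [simp, measurable_cong]: "sets \<mu> = sets borel" by (simp add: \<mu>(2))
  have \<gamma>T_sets [simp, measurable_cong]: "sets \<gamma>T = sets borel" by (simp add: \<gamma>T_def)

  define \<nu> where "\<nu> \<epsilon> = density lborel (\<lambda>y. ennreal ((1 - \<epsilon>) * \<rho> y + \<epsilon> * gauss_density T y))" for \<epsilon>
  have \<nu>_sets [simp, measurable_cong]: "sets (\<nu> \<epsilon>) = sets borel" for \<epsilon> by (simp add: \<nu>_def)
  have \<nu>_mix: "emeasure (\<nu> \<epsilon>) A = ennreal ((1 - \<epsilon>) * measure \<mu> A + \<epsilon> * measure \<gamma>T A)"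
    if \<epsilon>: "\<epsilon> \<in> {0<..<1}" and [measurable]: "A \<in> sets borel" for \<epsilon> A
  proof -
    have "emeasure (\<nu> \<epsilon>) A = (\<integral>\<^sup>+y. ennreal (1 - \<epsilon>) * (ennreal (\<rho> y) * indicator A y)
         + ennreal \<epsilon> * (ennreal (gauss_density T y) * indicator A y) \<partial>lborel)"
      unfolding \<nu>_def using \<epsilon> \<rho>(2)
      by (subst emeasure_density) (auto intro!: nn_integral_cong simp: ennreal_mult ennreal_plus split: split_indicator)
    also have "\<dots> = ennreal (1 - \<epsilon>) * emeasure \<mu> A + ennreal \<epsilon> * emeasure \<gamma>T A"
      unfolding \<mu>(2) \<gamma>T_def by (subst nn_integral_add) (auto simp: nn_integral_cmult emeasure_density)
    also have "\<dots> = ennreal ((1 - \<epsilon>) * measure \<mu> A + \<epsilon> * measure \<gamma>T A)"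
      using \<epsilon> by (simp add: \<mu>.emeasure_eq_measure \<gamma>T.emeasure_eq_measure ennreal_mult[symmetric] ennreal_plus[symmetric] del: ennreal_plus)
    finally show ?thesis .
  qed
  have \<nu>_prob: "prob_space (\<nu> \<epsilon>)" if "\<epsilon> \<in> {0<..<1}" for \<epsilon>
    using \<nu>_mix[OF that, of UNIV] \<mu>.prob_space \<gamma>T.prob_space
    by (intro prob_spaceI) (simp add: sets_eq_imp_space_eq[OF \<nu>_sets] sets_eq_imp_space_eq[OF \<mu>_sets] sets_eq_imp_space_eq[OF \<gamma>T_sets])
  have \<nu>_close: "tv_dist (\<nu> \<epsilon>) \<mu> \<le> \<epsilon>" if \<epsilon>: "\<epsilon> \<in> {0<..<1}" for \<epsilon>
  proof (rule tv_dist_least)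
    fix A :: "(real ^ 'd) set" assume A: "A \<in> sets borel"
    have "measure (\<nu> \<epsilon>) A = (1 - \<epsilon>) * measure \<mu> A + \<epsilon> * measure \<gamma>T A"
      using \<nu>_mix[OF \<epsilon> A] \<epsilon> by (intro measure_eq_emeasure_eq_ennreal) auto
    hence "measure (\<nu> \<epsilon>) A - measure \<mu> A = \<epsilon> * (measure \<gamma>T A - measure \<mu> A)" by (simp add: algebra_simps)
    thus "\<bar>measure (\<nu> \<epsilon>) A - measure \<mu> A\<bar> \<le> \<epsilon>"
      using tv_dist_bdd[OF \<gamma>T \<mu>(1), of A] \<epsilon> by (simp add: abs_mult mult_left_le)
  qed

  have euler: "(\<lambda>n. tv_dist (distr M borel (Y \<epsilon> n n)) (\<nu> \<epsilon>)) \<longlonglongrightarrow> 0"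
    and Y_prob: "\<And>n. prob_space (distr M borel (Y \<epsilon> n n))" if \<epsilon>: "\<epsilon> \<in> {0<..<1}" for \<epsilon>
  proof -
    define F where "F = (\<lambda>y. (1 - \<epsilon>) * \<phi> y + \<epsilon>)"
    define K where "K = 4 * (C\<^sub>1 * (1 + 1 / \<epsilon>))"
    have K: "K \<ge> 0" using C\<^sub>1 \<epsilon> by (simp add: K_def)
    have F_ge: "F y \<ge> \<epsilon>" for y using \<epsilon> \<phi>nn[of y] by (simp add: F_def)
    have F: "log_lipschitz K F"
      unfolding K_def F_def using \<epsilon> C\<^sub>1 \<phi>nn by (intro log_lipschitz_mixture) auto
    note [measurable] = log_lipschitzD(1)[OF K F]
    \<comment> \<open>\<open>F\<close> is the density of \<open>\<nu> \<epsilon>\<close> relative to the Gaussian law of variance \<open>T\<close>, so the transform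
      started at 0 ends in \<open>\<nu> \<epsilon>\<close>.\<close>
    have F\<nu>: "(\<integral>\<^sup>+z. f (sqrt T *\<^sub>R z) * ennreal (F (sqrt T *\<^sub>R z)) \<partial>std_gauss) = (\<integral>\<^sup>+y. f y \<partial>\<nu> \<epsilon>)"
      if [measurable]: "f \<in> borel_measurable borel" for f
    proof -
      have "F y * gauss_density T y = (1 - \<epsilon>) * \<rho> y + \<epsilon> * gauss_density T y" for y
        using G[of y] by (simp add: F_def \<phi> distrib_right)
      hence *: "ennreal (F y) * ennreal (gauss_density T y) = ennreal ((1 - \<epsilon>) * \<rho> y + \<epsilon> * gauss_density T y)" for y
        using F_ge[of y] \<epsilon> by (simp add: ennreal_mult[symmetric])
      have "(\<integral>\<^sup>+z. f (sqrt T *\<^sub>R z) * ennreal (F (sqrt T *\<^sub>R z)) \<partial>std_gauss)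
          = (\<integral>\<^sup>+y. f y * ennreal (F y) * ennreal (gauss_density T y) \<partial>lborel)"
        by (rule nn_integral_std_gauss_scaled[OF _ T]) measurable
      also have "\<dots> = (\<integral>\<^sup>+y. f y \<partial>\<nu> \<epsilon>)"
        unfolding \<nu>_def mult.assoc * by (subst nn_integral_density) (auto simp: mult.commute)
      finally show ?thesis .
    qed
    have "ennreal (heat T F 0) = 1"
      using F\<nu>[of "\<lambda>_. 1"] prob_space.emeasure_space_1[OF \<nu>_prob[OF \<epsilon>]]
      by (simp add: ennreal_heat[OF K F])
    hence doob: "doob T F f 0 = (\<integral>\<^sup>+y. f y \<partial>\<nu> \<epsilon>)" if "f \<in> borel_measurable borel" for f
      using F\<nu>[OF that] by (simp add: doob_def divide_ennreal_def)
    obtain C where C: "C > 0"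
      "\<And>F s h x. log_lipschitz K (F :: real ^ 'd \<Rightarrow> real) \<Longrightarrow> 0 \<le> s \<Longrightarrow> 0 < h \<Longrightarrow> s + h \<le> T \<Longrightarrow>
       euler_ratio_moment s h F x \<le> ennreal (1 + C * (h\<^sup>2 / max s h))"
      by (rule chi_square_one_step[OF K T, where 'a="real ^ 'd"]) blast
    have b: "drift M Z\<^sub>0 T \<phi> \<epsilon> t = heat_drift (T - t) F" if "t < T" for t
      using drift_eq_heat_grad[OF K F[unfolded F_def] _ _ Z\<^sub>0 that] \<epsilon> by (simp add: F_def)
    have Y_eq: "distr M borel (Y \<epsilon> n n) = distr M borel (euler_maruyama (drift M Z\<^sub>0 T \<phi> \<epsilon>) T n (Z \<epsilon> n) n)" for n
      by (rule distr_cong) (simp_all add: Y[OF \<epsilon>])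
    have le: "tv_dist (distr M borel (Y \<epsilon> n n)) (\<nu> \<epsilon>) \<le> sqrt (exp (C * T * ((1 + harm n) / real n)) - 1)"
      if n: "n > 0" for n
      unfolding Y_eq
      by (rule M.tv_dist_euler_maruyama_le[OF K F T Z(1)[OF \<epsilon>] distr_std_normal_vector(2)[OF Z(2)[OF \<epsilon>]]
            b C(2)[OF F] C(1) n \<nu>_prob[OF \<epsilon>] \<nu>_sets doob])
    show prob: "prob_space (distr M borel (Y \<epsilon> n n))" for n
      unfolding Y_eq
    proof (rule M.prob_space_distr, rule euler_maruyama_measurable)
      show "drift M Z\<^sub>0 T \<phi> \<epsilon> (real j * T / real n) \<in> borel_measurable borel" if "j < n" for j
      proof -
        note [measurable] = heat_measurable[OF K F]
        have "real j * T / real n < T" using that T by (simp add: field_simps)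
        thus ?thesis by (subst b) (auto simp: heat_drift_measurable[OF K F])
      qed
    qed (rule distr_std_normal_vector(1)[OF Z(2)[OF \<epsilon>]])
    show "(\<lambda>n. tv_dist (distr M borel (Y \<epsilon> n n)) (\<nu> \<epsilon>)) \<longlonglongrightarrow> 0"
    proof (rule tendsto_sandwich[of "\<lambda>_. 0" _ _ "\<lambda>n. sqrt (exp (C * T * ((1 + harm n) / real n)) - 1)"])
      show "\<forall>\<^sub>F n in sequentially. 0 \<le> tv_dist (distr M borel (Y \<epsilon> n n)) (\<nu> \<epsilon>)"
        using tv_dist_upper[OF prob \<nu>_prob[OF \<epsilon>], of "{}"] by simp
      show "\<forall>\<^sub>F n in sequentially. tv_dist (distr M borel (Y \<epsilon> n n)) (\<nu> \<epsilon>)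
          \<le> sqrt (exp (C * T * ((1 + harm n) / real n)) - 1)"
        using eventually_gt_at_top[of 0] by eventually_elim (rule le)
      have "(\<lambda>n. sqrt (exp (C * T * ((1 + harm n) / real n)) - 1)) \<longlonglongrightarrow> sqrt (exp (C * T * 0) - 1)"
        by (intro tendsto_intros harm_over_n_tendsto_0)
      thus "(\<lambda>n. sqrt (exp (C * T * ((1 + harm n) / real n)) - 1)) \<longlonglongrightarrow> 0" by simp
    qed simp
  qed
  have lims: "(\<lambda>n. tv_dist (distr M borel (Y \<epsilon> n n)) \<mu>) \<longlonglongrightarrow> tv_dist (\<nu> \<epsilon>) \<mu>" if \<epsilon>: "\<epsilon> \<in> {0<..<1}" for \<epsilon>
  proof (rule LIM_zero_cancel, rule Lim_null_comparison[OF _ euler[OF \<epsilon>]])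
    show "\<forall>\<^sub>F n in sequentially. norm (tv_dist (distr M borel (Y \<epsilon> n n)) \<mu> - tv_dist (\<nu> \<epsilon>) \<mu>)
        \<le> tv_dist (distr M borel (Y \<epsilon> n n)) (\<nu> \<epsilon>)"
      unfolding real_norm_def
      by (intro always_eventually allI tv_dist_perturb Y_prob[OF \<epsilon>] \<nu>_prob[OF \<epsilon>] \<mu>(1))
  qed
  have "((\<lambda>\<epsilon>. lim (\<lambda>n. tv_dist (distr M borel (Y \<epsilon> n n)) \<mu>)) \<longlongrightarrow> 0) (at_right 0)"
  proof (rule tendsto_sandwich[of "\<lambda>_. 0" _ _ "\<lambda>\<epsilon>. \<epsilon>"])
    have ev: "\<forall>\<^sub>F \<epsilon> in at_right (0::real). \<epsilon> \<in> {0<..<1}"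
      by (rule eventually_at_right_real) simp
    show "\<forall>\<^sub>F \<epsilon> in at_right 0. 0 \<le> lim (\<lambda>n. tv_dist (distr M borel (Y \<epsilon> n n)) \<mu>)"
      using ev
    proof eventually_elim
      case (elim \<epsilon>)
      show ?case using tv_dist_upper[OF \<nu>_prob[OF elim] \<mu>(1), of "{}"] by (simp add: limI[OF lims[OF elim]])
    qed
    show "\<forall>\<^sub>F \<epsilon> in at_right 0. lim (\<lambda>n. tv_dist (distr M borel (Y \<epsilon> n n)) \<mu>) \<le> \<epsilon>"
      using ev
    proof eventually_elim
      case (elim \<epsilon>)
      show ?case using \<nu>_close[OF elim] by (simp add: limI[OF lims[OF elim]])
    qed
  qed (auto intro: tendsto_ident_at)
  moreover have "convergent (\<lambda>n. tv_dist (distr M borel (Y \<epsilon> n n)) \<mu>)" if "\<epsilon> \<in> {0<..<1}" for \<epsilon>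
    using lims[OF that] unfolding convergent_def by (rule exI)
  ultimately show ?thesis by blast
qed

end
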